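(* Fix positive integers $d_2,g$ and a multiset $\Delta=\{L_1,\dots,L_{d_2}\}$ of integers such that $\sum_{i=1}^{d_2}L_i=0$. The generating series of counts of curled pearl chains of type $(\Delta,d_2,g)$ equals a sum of Feynman integrals: $$\sum_{d_1} N^{\operatorname{pearl}}_{(\Delta,d_1,d_2,g)}\, q^{d_1}= \sum_{\mathcal{P}} \frac{1}{|\operatorname{Aut}(\mathcal{P})|}\sum_{v}\sum_{\Omega} I^v_{\mathcal{P},\Omega}(q).$$ The first sum on the right hand side goes over all (isomorphism classes of) pearl chains $\mathcal{P}$ of type $(d_2,g)$, the second over all vectors $v$ which associate the leakings $L_1,\dots,L_{d_2}$ to the white vertices of $\mathcal{P}$ and $0$ to the black vertices, and the third over all total orders $\Omega$ of the vertices of $\mathcal{P}$.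
   Context: **Pearl chains.** A pearl chain of type $(d_2,g)$ is a (non-metric) connected graph $\mathcal{P}$ of genus (first Betti number) $g$ with $d_2$ white and $d_2+g-1$ black vertices; edges only connect a white with a black vertex; black vertices are $2$-valent, white vertices can have any valency; there are no cycles of length two. $\operatorname{Aut}(\mathcal{P})$ is the group of colour-preserving graph automorphisms. **Curled pearl chains.** A tropical elliptic curve $E_{\mathbb{T}}$ is a circle of fixed length. A tropical cover $\pi:\Gamma_1\to\Gamma_2$ is a surjective map of metric graphs, integer affine linear on edges, whose slope on each edge (or flag) $e$ is a positive integer $w_e$, the expansion factor. For $v\in\Gamma_1$ and a flag $f'$ at $\pi(v)$, the local degree $d_{v,f'}$ is the sum of the $w_f$ over all flags $f$ at $v$ mapping to $f'$. The cover is balanced at $v$ if $d_{v,f'}$ is independent of $f'$. For $\Gamma_2=E_{\mathbb{T}}$ oriented, with $f_1,f_2$ the two flags at $\pi(v)$, ordered such that the orientation is respected ($f_1$ before $f_2$), there is a leaking of $L\in\mathbb{Z}$ at $v$ if $d_{v,f_1}-d_{v,f_2}=L$. A leaky tropical cover is one where vertices may have leaking. The degree of a leaky tropical cover of $E_{\mathbb{T}}$ is the minimum over points $a$ and adjacent flags $f'$ of $\sum_{p\mapsto a}d_{p,f'}$. Fix on $E_{\mathbb{T}}$ points $p_0,\dots,p_n$, $n=2d_2+g-1$, which fix an orientation of $E_{\mathbb{T}}$. A curled pearl chain of type $(\Delta,d_2,g)$ is a leaky tropical cover $\pi:\mathcal{P}'\to E_{\mathbb{T}}$, where $\mathcal{P}'$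 is a metrization of a pearl chain $\mathcal{P}$ of type $(d_2,g)$, such that each $\pi^{-1}(p_i)$, $i=1,\dots,n$, contains one vertex, each element $L$ of $\Delta$ corresponds to a white vertex with leaking $L$, and the black vertices are balanced. $N^{\operatorname{pearl}}_{(\Delta,d_1,d_2,g)}$ is the number of curled pearl chains of type $(\Delta,d_2,g)$ and degree $d_1$, each counted with multiplicity $\prod_e w_e$ over all edges. **Feynman integrals.** Let $$P(x,q)=-\sum_{d=1}^\infty d\,x^d-\sum_{n=1}^\infty\Bigl(\sum_{d\mid n}d\,(x^d+x^{-d})\Bigr)q^n .$$ Let $\mathcal{P}$ be a pearl chain with vertices labeled $x_1,\dots,x_n$ and edges labeled $q_1,\dots,q_r$, and let $\Omega$ be a total order of its $n$ vertices. Denote the vertices adjacent to the edge $q_k$ by $x_{k^1},x_{k^2}$ with $x_{k^1}<x_{k^2}$ in $\Omega$. For integers $v=(l_1,\dots,l_n)$, $$I^{v}_{\mathcal{P},\Omega}(q)=\operatorname{Coef}_{[x_1^{l_1}\cdots x_n^{l_n}]}\prod_{k=1}^rP\Bigl(\frac{x_{k^1}}{x_{k^2}},q\Bigr).$$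
   Formalization: The degree is taken as the sum of local degrees over p_0, not the minimum over all points and flags, and covers need not be surjective; as printed the identity fails for nonzero leakings, e.g. d_2=2, g=1, Δ={1,-1} gives 16 versus 8 at q^1. *)

theory Defs
  imports
    "HOL-Library.Multiset"
    "HOL-Library.FuncSet"
    "HOL-Library.Groups_Big_Fun"
    "HOL-Library.Real_Mod"
    "HOL-Combinatorics.Permutations"
    "HOL-Computational_Algebra.Formal_Power_Series"
begin

section \<open>Pearl chains\<close>

text \<open>
  The edges of a pearl chain join a white to a black vertex and there are no cycles of length two,
  so there are neither loops nor multiple edges: an edge is the pair (white end, black end).
\<close>

definition pearl_chain :: "nat \<Rightarrow> nat \<Rightarrow> 'v set \<Rightarrow> 'v set \<Rightarrow> ('v \<times> 'v) set \<Rightarrow> bool" where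
  "pearl_chain d2 g W B E \<longleftrightarrow>
     finite W \<and> finite B \<and> W \<inter> B = {} \<and> card W = d2 \<and> card B + 1 = d2 + g \<and>
     E \<subseteq> W \<times> B \<and>
     (\<forall>b\<in>B. card {e \<in> E. snd e = b} = 2) \<and>
     (\<forall>x\<in>W \<union> B. \<forall>y\<in>W \<union> B. (x, y) \<in> (E \<union> E\<inverse>)\<^sup>*) \<and>
     int (card E) - int (card (W \<union> B)) + 1 = int g"

definition colour_isos ::
    "'v set \<Rightarrow> 'v set \<Rightarrow> ('v \<times> 'v) set \<Rightarrow> ('v \<times> 'v) set \<Rightarrow> ('v \<Rightarrow> 'v) set" where
  "colour_isos W B E E' =
     {f. f permutes (W \<union> B) \<and> f ` W = W \<and> f ` B = B \<and> map_prod f f ` E = E'}"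

definition aut_group :: "'v set \<Rightarrow> 'v set \<Rightarrow> ('v \<times> 'v) set \<Rightarrow> ('v \<Rightarrow> 'v) set" where
  "aut_group W B E = colour_isos W B E E"

definition iso_classes :: "'a set \<Rightarrow> ('a \<Rightarrow> 'a \<Rightarrow> bool) \<Rightarrow> 'a set set" where
  "iso_classes S R = S // {(x, y). x \<in> S \<and> y \<in> S \<and> R x y}"

definition representative :: "'a set \<Rightarrow> 'a" where
  "representative K = (SOME x. x \<in> K)"

text \<open>
  Every pearl chain of type \<open>(d2, g)\<close> is isomorphic to one with the following vertex sets, so
  isomorphism classes are formed among the pearl chains on these vertices.
\<close>

definition whites :: "nat \<Rightarrow> nat set" where
  "whites d2 = {..<d2}"

definition blacks :: "nat \<Rightarrow> nat \<Rightarrow> nat set" where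
  "blacks d2 g = {d2..<2 * d2 + g - 1}"

definition vertices :: "nat \<Rightarrow> nat \<Rightarrow> nat set" where
  "vertices d2 g = whites d2 \<union> blacks d2 g"

definition pearl_chain_classes :: "nat \<Rightarrow> nat \<Rightarrow> (nat \<times> nat) set set set" where
  "pearl_chain_classes d2 g =
     iso_classes {E. pearl_chain d2 g (whites d2) (blacks d2 g) E}
       (\<lambda>E E'. colour_isos (whites d2) (blacks d2 g) E E' \<noteq> {})"


section \<open>Leaky covers of a tropical elliptic curve\<close>

text \<open>
  The tropical elliptic curve of length \<open>l\<close> is the oriented circle of reals modulo \<open>l\<close>, a point
  being represented by its representative in \<open>{0..<l}\<close>. A point of a metric graph is a vertex or
  the point \<open>Inner (w, b) t\<close> on the edge \<open>(w, b)\<close> at distance \<open>t\<close> from \<open>w\<close>, where \<open>t\<close> lies strictly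
  between \<open>0\<close> and the edge length.
\<close>

datatype 'v point = Vertex 'v | Inner "'v \<times> 'v" real

record 'v metric_cover =
  edges :: "('v \<times> 'v) set"
  len :: "'v \<times> 'v \<Rightarrow> real"
  proj :: "'v point \<Rightarrow> real"

definition points :: "'v set \<Rightarrow> 'v metric_cover \<Rightarrow> 'v point set" where
  "points V C = Vertex ` V \<union> {Inner e t |e t. e \<in> edges C \<and> 0 < t \<and> t < len C e}"

text \<open>
  \<open>s\<close> is the slope with respect to the direction of the edge from its white to its black end; its
  sign says whether this direction agrees with the orientation of the circle, and \<open>\<bar>s\<bar>\<close> is the
  expansion factor.
\<close>

definition has_slope :: "real \<Rightarrow> 'v metric_cover \<Rightarrow> 'v \<times> 'v \<Rightarrow> int \<Rightarrow> bool" where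
  "has_slope l C e s \<longleftrightarrow>
     s \<noteq> 0 \<and>
     (\<forall>t. 0 < t \<and> t < len C e \<longrightarrow>
        proj C (Inner e t) = (proj C (Vertex (fst e)) + of_int s * t) rmod l) \<and>
     proj C (Vertex (snd e)) = (proj C (Vertex (fst e)) + of_int s * len C e) rmod l"

definition slope :: "real \<Rightarrow> 'v metric_cover \<Rightarrow> 'v \<times> 'v \<Rightarrow> int" where
  "slope l C e = (THE s. has_slope l C e s)"

definition expansion :: "real \<Rightarrow> 'v metric_cover \<Rightarrow> 'v \<times> 'v \<Rightarrow> nat" where
  "expansion l C e = nat \<bar>slope l C e\<bar>"

text \<open>
  The two flags at a point of the oriented circle: \<open>Before\<close> is the one through which the
  orientation enters the point, \<open>After\<close> the one through which it leaves.
\<close>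

datatype circle_flag = Before | After

definition flag_image :: "real \<Rightarrow> 'v metric_cover \<Rightarrow> 'v \<Rightarrow> 'v \<times> 'v \<Rightarrow> circle_flag" where
  "flag_image l C v e = (if (v = fst e) = (0 < slope l C e) then After else Before)"

fun local_degree :: "real \<Rightarrow> 'v metric_cover \<Rightarrow> 'v point \<Rightarrow> circle_flag \<Rightarrow> nat" where
  "local_degree l C (Vertex v) f =
     (\<Sum>e | e \<in> edges C \<and> (v = fst e \<or> v = snd e) \<and> flag_image l C v e = f. expansion l C e)"
| "local_degree l C (Inner e t) f = expansion l C e"

definition leaking :: "real \<Rightarrow> 'v metric_cover \<Rightarrow> 'v \<Rightarrow> int" where
  "leaking l C v =
     int (local_degree l C (Vertex v) Before) - int (local_degree l C (Vertex v) After)"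

definition fibre_degree ::
    "real \<Rightarrow> 'v set \<Rightarrow> 'v metric_cover \<Rightarrow> real \<Rightarrow> circle_flag \<Rightarrow> nat" where
  "fibre_degree l V C a f = (\<Sum>x | x \<in> points V C \<and> proj C x = a. local_degree l C x f)"

text \<open>
  Images need not be all of the circle: at a vertex with nonzero leaking one of the two local
  degrees may vanish, and then some arc of the circle can have empty preimage. These covers
  contribute to the Feynman integrals and must be counted.
\<close>

definition curled_pearl_chain ::
    "real \<Rightarrow> (nat \<Rightarrow> real) \<Rightarrow> int multiset \<Rightarrow> nat \<Rightarrow> nat \<Rightarrow> nat metric_cover \<Rightarrow> bool" where
  "curled_pearl_chain l p \<Delta> d2 g C \<longleftrightarrow>
     pearl_chain d2 g (whites d2) (blacks d2 g) (edges C) \<and>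
     (\<forall>e\<in>edges C. 0 < len C e) \<and>
     proj C ` points (vertices d2 g) C \<subseteq> {0..<l} \<and>
     (\<forall>e\<in>edges C. \<exists>s. has_slope l C e s) \<and>
     (\<forall>i\<in>{1..2 * d2 + g - 1}. \<exists>!v. v \<in> vertices d2 g \<and> proj C (Vertex v) = p i) \<and>
     image_mset (leaking l C) (mset_set (whites d2)) = \<Delta> \<and>
     (\<forall>b\<in>blacks d2 g. leaking l C b = 0)"

definition cover_iso :: "nat \<Rightarrow> nat \<Rightarrow> nat metric_cover \<Rightarrow> nat metric_cover \<Rightarrow> bool" where
  "cover_iso d2 g C C' \<longleftrightarrow>
     (\<exists>f\<in>colour_isos (whites d2) (blacks d2 g) (edges C) (edges C').
        (\<forall>e\<in>edges C. len C' (map_prod f f e) = len C e) \<and>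
        (\<forall>v\<in>vertices d2 g. proj C' (Vertex (f v)) = proj C (Vertex v)) \<and>
        (\<forall>e\<in>edges C. \<forall>t. 0 < t \<and> t < len C e \<longrightarrow>
           proj C' (Inner (map_prod f f e) t) = proj C (Inner e t)))"

text \<open>
  The sum of the local degrees over a point of the circle changes by \<open>- L\<close> when the point
  passes the image of a vertex with leaking \<open>L\<close>. The degree is read off at the base point \<open>p 0\<close>,
  over which there is no vertex, so that the choice of the flag there does not matter. If all
  leakings vanish, the sum is constant and the degree is its minimum over all points and flags;
  in general it is not the minimum, and the minimum does not satisfy the identity with Feynman
  integrals: for \<open>d2 = 2\<close>, \<open>g = 1\<close> and leakings \<open>1, -1\<close> the covers with minimum \<open>1\<close> contribute \<open>16\<close>,
  while the coefficient of \<open>q\<close> on the Feynman side is \<open>8\<close>.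
\<close>

definition cover_degree :: "real \<Rightarrow> (nat \<Rightarrow> real) \<Rightarrow> nat \<Rightarrow> nat \<Rightarrow> nat metric_cover \<Rightarrow> nat" where
  "cover_degree l p d2 g C = fibre_degree l (vertices d2 g) C (p 0) After"

definition multiplicity_of :: "real \<Rightarrow> 'v metric_cover \<Rightarrow> nat" where
  "multiplicity_of l C = (\<Prod>e\<in>edges C. expansion l C e)"

definition N_pearl ::
    "real \<Rightarrow> (nat \<Rightarrow> real) \<Rightarrow> int multiset \<Rightarrow> nat \<Rightarrow> nat \<Rightarrow> nat \<Rightarrow> nat" where
  "N_pearl l p \<Delta> d1 d2 g =
     (\<Sum>K\<in>iso_classes {C. curled_pearl_chain l p \<Delta> d2 g C \<and> cover_degree l p d2 g C = d1}
             (cover_iso d2 g).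
        multiplicity_of l (representative K))"


section \<open>Feynman integrals\<close>

text \<open>
  A formal series in \<open>q\<close> and Laurent monomials in variables indexed by \<open>'v\<close>: \<open>F m n\<close> is the
  coefficient of \<open>x\<^sup>m q\<^sup>n\<close>, where \<open>m\<close> is the vector of exponents.
\<close>

type_synonym 'v series = "('v \<Rightarrow> int) \<Rightarrow> nat \<Rightarrow> rat"

text \<open>\<open>propagator a n\<close> is the coefficient of \<open>x\<^sup>a q\<^sup>n\<close> in \<open>P(x, q)\<close>.\<close>

definition propagator :: "int \<Rightarrow> nat \<Rightarrow> rat" where
  "propagator a n =
     (if n = 0 then (if 1 \<le> a then - of_int a else 0)
      else - (\<Sum>d | d dvd n. of_nat d * (of_bool (a = int d) + of_bool (a = - int d))))"

text \<open>
  \<open>P(x\<^sub>u/x\<^sub>v, q)\<close> for \<open>u \<noteq> v\<close>: the monomials that occur are those with exponent \<open>a\<close> at \<open>u\<close>, \<open>-a\<close> at \<open>v\<close>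
  and \<open>0\<close> elsewhere.
\<close>

definition propagator_at :: "'v \<Rightarrow> 'v \<Rightarrow> 'v series" where
  "propagator_at u v m n =
     (if m v = - m u \<and> (\<forall>x. x \<noteq> u \<and> x \<noteq> v \<longrightarrow> m x = 0) then propagator (m u) n else 0)"

text \<open>
  The coefficient of \<open>x\<^sup>m q\<^sup>n\<close> in the product of the \<open>F k\<close>, \<open>k \<in> K\<close>: the sum over all ways of writing
  the monomial as a product of one monomial for each factor. The edge factors of a Feynman
  integral are expanded compatibly with one total order, so only finitely many summands are
  nonzero.
\<close>

definition series_prod :: "'k set \<Rightarrow> ('k \<Rightarrow> 'v series) \<Rightarrow> 'v series" where
  "series_prod K F m n =
     Sum_any (\<lambda>c. if c \<in> extensional K \<and> (\<forall>x. (\<Sum>k\<in>K. fst (c k) x) = m x) \<and> (\<Sum>k\<in>K. snd (c k)) = n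
                  then \<Prod>k\<in>K. F k (fst (c k)) (snd (c k)) else 0)"

text \<open>Total orders \<open>r\<close> are relations, \<open>(x, y) \<in> r\<close> meaning \<open>x \<le> y\<close>.\<close>

definition edge_factor :: "('v \<times> 'v) set \<Rightarrow> 'v \<times> 'v \<Rightarrow> 'v series" where
  "edge_factor r e =
     (if e \<in> r then propagator_at (fst e) (snd e) else propagator_at (snd e) (fst e))"

definition feynman_integral :: "('v \<times> 'v) set \<Rightarrow> ('v \<times> 'v) set \<Rightarrow> ('v \<Rightarrow> int) \<Rightarrow> rat fps" where
  "feynman_integral E r v = Abs_fps (\<lambda>n. series_prod E (edge_factor r) v n)"

definition leak_vectors :: "'v set \<Rightarrow> int multiset \<Rightarrow> ('v \<Rightarrow> int) set" where
  "leak_vectors W \<Delta> = {v. image_mset v (mset_set W) = \<Delta> \<and> (\<forall>x. x \<notin> W \<longrightarrow> v x = 0)}"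

end

theory Submission
  imports Defs
begin

text \<open>
  Both sides count the same combinatorial objects, weighted by the product of the expansion factors.

  A curled pearl chain sends the \<open>N = 2 * d2 + g - 1\<close> vertices bijectively to \<open>p 1, \<dots>, p N\<close>. An edge
  from a white vertex over \<open>a\<close> to a black vertex over \<open>b\<close> is determined by its signed slope \<open>s\<close> and by
  the number \<open>m\<close> of its passages over the base point \<open>p 0\<close>: lifting the edge to the universal cover of
  the circle shows that its length \<open>L\<close> satisfies \<open>s * L = b - a + sgn s * m * l\<close>. Every pair \<open>(s, m)\<close>
  for which this \<open>L\<close> is positive occurs. For \<open>m > 0\<close> that is every pair with \<open>s \<noteq> 0\<close>; for \<open>m = 0\<close> the
  sign of \<open>s\<close> is the one of \<open>b - a\<close>. Hence curled pearl chains with labelled vertices are the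
  same as diagrams: a pearl chain \<open>E\<close>, a placement of its vertices and a flow, that is, an admissible
  pair for each edge. The leaking of the cover is the excess of the flow at the vertices, and its
  degree over \<open>p 0\<close> is the sum of the \<open>\<bar>s\<bar> * m\<close>.

  On the Feynman side, the terms in the propagator of an edge with white end \<open>w\<close> and black end \<open>b\<close> are
  \<open>- \<bar>s\<bar> (x\<^sub>b / x\<^sub>w)\<^sup>s q\<^bsup>\<bar>s\<bar> m\<^esup>\<close>, where only one sign of \<open>s\<close> is allowed if \<open>m = 0\<close>. If the total order is
  the one in which vertices decrease along the circle, these are exactly the admissible pairs, the
  exponents contribute to the leak vector what the edge contributes to the excess, and the signs cancel,
  because every black vertex has two edges and so the number of edges is even. Therefore the integrals of one pearl chain
  add up to the weighted number of diagrams on it (\<open>chain_weight_eq_feynman\<close>). The expansion of the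
  product is a finite sum by a cut argument (\<open>flow_cut_bound\<close>): edges with \<open>m = 0\<close> all run in the
  same direction along the circle, so none of them can carry more than the leaking and the degree allow.

  It remains to compare the symmetries. Two covers are isomorphic iff their diagrams are related by a
  colour-preserving permutation of the vertices (\<open>cover_iso_iff\<close>), and the group of these
  permutations acts freely on diagrams because a placement is injective. So the weighted number of
  isomorphism classes of covers is the weighted number of diagrams divided by the order of the group.
  The same group acts on pearl chains, with the automorphism groups as stabilisers, and the orbit-stabiliser theorem turns
  the sum over classes with weights \<open>1 / \<bar>Aut\<bar>\<close> into the sum over all labelled pearl chains divided by
  the order of the group. Both counts are instances of \<open>sum_over_isomorphism_classes\<close>.
\<close>

section \<open>Sums over isomorphism classes\<close>

lemma representative_mem:
  assumes "K \<in> iso_classes S R" "\<And>x. x \<in> S \<Longrightarrow> R x x"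
  shows "representative K \<in> S"
proof -
  obtain x where x: "x \<in> S" "K = {(x, y). x \<in> S \<and> y \<in> S \<and> R x y} `` {x}"
    using assms(1) by (auto simp: iso_classes_def elim: quotientE)
  then have "\<exists>y. y \<in> K" using assms(2) by blast
  then have "representative K \<in> K" unfolding representative_def by (rule someI_ex)
  then show ?thesis using x by auto
qed

text \<open>
  The orbit-stabiliser theorem, summed over orbits. The isomorphism relation lives on a possibly
  infinite set \<open>S\<close>, such as the set of all metric covers; \<open>code\<close> maps \<open>S\<close> onto a finite set \<open>D\<close> on
  which a group \<open>G\<close> of bijections acts, in such a way that the isomorphism classes are the preimages of
  the orbits.
\<close>

lemma sum_over_isomorphism_classes:
  fixes act :: "('v \<Rightarrow> 'v) \<Rightarrow> 'd \<Rightarrow> 'd" and f :: "'d \<Rightarrow> rat" and code :: "'c \<Rightarrow> 'd"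
  assumes fin: "finite G" "finite D"
    and G: "id \<in> G" "\<And>h k. h \<in> G \<Longrightarrow> k \<in> G \<Longrightarrow> h \<circ> k \<in> G"
      "\<And>h. h \<in> G \<Longrightarrow> bij h" "\<And>h. h \<in> G \<Longrightarrow> inv h \<in> G"
    and act: "\<And>h d. h \<in> G \<Longrightarrow> d \<in> D \<Longrightarrow> act h d \<in> D" "\<And>d. d \<in> D \<Longrightarrow> act id d = d"
      "\<And>h k d. h \<in> G \<Longrightarrow> k \<in> G \<Longrightarrow> d \<in> D \<Longrightarrow> act (h \<circ> k) d = act h (act k d)"
    and code: "code ` S = D"
    and R: "\<And>x y. x \<in> S \<Longrightarrow> y \<in> S \<Longrightarrow> R x y \<longleftrightarrow> (\<exists>h\<in>G. act h (code x) = code y)"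
    and f: "\<And>h d. h \<in> G \<Longrightarrow> d \<in> D \<Longrightarrow> f (act h d) = f d"
  shows "(\<Sum>K\<in>iso_classes S R. f (code (representative K)) /
            of_nat (card {h \<in> G. act h (code (representative K)) = code (representative K)})) =
         (\<Sum>d\<in>D. f d) / of_nat (card G)"
proof -
  define rel where "rel = {(x, y). x \<in> S \<and> y \<in> S \<and> R x y}"
  have act_inv: "act (inv h) (act h d) = d" if "h \<in> G" "d \<in> D" for h d
    using act(3)[of "inv h" h d] act(2)[of d] that G(3,4)[of h]
    by (simp add: bij_is_inj)
  have equiv: "equiv S rel"
  proof (rule equivI)
    show "refl_on S rel"
      using R act(2) G(1) code unfolding refl_on_def rel_def by blast
    show "rel \<subseteq> S \<times> S" by (auto simp: rel_def)
    show "sym rel"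
    proof (rule symI)
      fix x y assume "(x, y) \<in> rel"
      then obtain h where h: "h \<in> G" "act h (code x) = code y" "x \<in> S" "y \<in> S"
        using R by (auto simp: rel_def)
      then have "act (inv h) (code y) = code x"
        using act_inv[of h "code x"] code by auto
      then show "(y, x) \<in> rel" using h R G(4) by (auto simp: rel_def)
    qed
    show "trans rel"
    proof (rule transI)
      fix x y z assume "(x, y) \<in> rel" "(y, z) \<in> rel"
      then obtain h k where h: "h \<in> G" "act h (code x) = code y" "x \<in> S" "y \<in> S"
         and k: "k \<in> G" "act k (code y) = code z" "z \<in> S"
        using R by (auto simp: rel_def)
      then have "act (k \<circ> h) (code x) = code z" using act(3) code by auto
      then show "(x, z) \<in> rel" using h k R[of x z] G(2)[of k h] unfolding rel_def by blast
    qed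
  qed
  have classes: "iso_classes S R = S // rel" by (simp add: iso_classes_def rel_def)
  have rep: "representative K \<in> K" "K \<subseteq> S" "K = rel `` {representative K}" if "K \<in> S // rel" for K
  proof -
    show mem: "representative K \<in> K"
      unfolding representative_def using in_quotient_imp_non_empty[OF equiv that] some_in_eq by blast
    show "K \<subseteq> S" using in_quotient_imp_subset[OF equiv that] .
    show "K = rel `` {representative K}"
      using equiv_class_eq_iff[OF equiv] quotientE[OF that] mem by (metis (full_types) Image_singleton_iff)
  qed
  have orbit: "code ` K = (\<lambda>h. act h (code (representative K))) ` G" if K: "K \<in> S // rel" for K
  proof -
    have x: "representative K \<in> S" using rep[OF K] by auto
    show ?thesis
    proof (intro equalityI subsetI)
      fix d assume "d \<in> code ` K"
      then obtain y where y: "y \<in> K" "d = code y" by auto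
      then have "(representative K, y) \<in> rel" using rep(3)[OF K] by auto
      then obtain h where "h \<in> G" "act h (code (representative K)) = code y"
        using R by (auto simp: rel_def)
      then show "d \<in> (\<lambda>h. act h (code (representative K))) ` G"
        using y(2) by (metis imageI)
    next
      fix d assume "d \<in> (\<lambda>h. act h (code (representative K))) ` G"
      then obtain h where h: "h \<in> G" "d = act h (code (representative K))" by auto
      then have "d \<in> code ` S" using act(1) code x by auto
      then obtain y where y: "y \<in> S" "d = code y" by auto
      then have "(representative K, y) \<in> rel" using R x h by (auto simp: rel_def)
      then have "y \<in> K" using rep(3)[OF K] by blast
      then show "d \<in> code ` K" using y by auto
    qed
  qed
  have disj: "code ` K \<inter> code ` K' = {}" if K: "K \<in> S // rel" and K': "K' \<in> S // rel" and "K \<noteq> K'" for K K'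
  proof (rule ccontr)
    assume "code ` K \<inter> code ` K' \<noteq> {}"
    then obtain x y where xy: "x \<in> K" "y \<in> K'" "code x = code y" by blast
    then have "x \<in> S" "y \<in> S" using rep K K' by blast+
    moreover have "act id (code x) = code y"
      using act(2)[of "code x"] code xy(3) imageI[OF \<open>x \<in> S\<close>, of code] by metis
    ultimately have "(x, y) \<in> rel" using R G(1) unfolding rel_def by blast
    then show False using quotient_eqI[OF equiv K K'] xy that by blast
  qed
  have ne: "code ` K \<noteq> {}" if "K \<in> S // rel" for K using rep(1)[OF that] by auto
  have finq: "finite (S // rel)"
  proof (rule inj_on_finite[of "(`) code" _ "Pow D"])
    show "inj_on ((`) code) (S // rel)"
      by (rule inj_onI) (metis disj ne inf.idem)
    show "(`) code ` (S // rel) \<subseteq> Pow D" using rep(2) code by auto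
  qed (simp add: fin)
  have orbit_stabiliser: "card G = card (code ` K) * card {h \<in> G. act h d = d}"
    if K: "K \<in> S // rel" and d: "d = code (representative K)" for K d
  proof -
    have dD: "d \<in> D" using rep[OF K] d code by auto
    have "card G = (\<Sum>y\<in>code ` K. card {h \<in> G. act h d = y})"
      using sum_fun_comp[of G "code ` K" "\<lambda>h. act h d" "\<lambda>_. 1::nat"] orbit[OF K] fin d
      by simp
    also have "\<dots> = (\<Sum>y\<in>code ` K. card {h \<in> G. act h d = d})"
    proof (rule sum.cong[OF refl])
      fix y assume "y \<in> code ` K"
      then obtain k where k: "k \<in> G" "y = act k d" using orbit[OF K] d by auto
      have "bij_betw (\<lambda>h. k \<circ> h) {h \<in> G. act h d = d} {h \<in> G. act h d = y}"
      proof (rule bij_betw_byWitness[of _ "\<lambda>h. inv k \<circ> h"])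
        show "\<forall>a\<in>{h \<in> G. act h d = d}. inv k \<circ> (k \<circ> a) = a"
          using G(3)[OF k(1)] by (auto simp: o_assoc bij_is_inj)
        show "\<forall>a\<in>{h \<in> G. act h d = y}. k \<circ> (inv k \<circ> a) = a"
          using G(3)[OF k(1)] by (auto simp: fun_eq_iff bij_is_surj surj_f_inv_f)
        show "(\<lambda>h. k \<circ> h) ` {h \<in> G. act h d = d} \<subseteq> {h \<in> G. act h d = y}"
          using act(3)[OF k(1) _ dD] G(2)[OF k(1)] k(2) by (simp add: image_subset_iff)
        show "(\<lambda>h. inv k \<circ> h) ` {h \<in> G. act h d = y} \<subseteq> {h \<in> G. act h d = d}"
          using act(3)[OF G(4)[OF k(1)] _ dD] G(2)[OF G(4)[OF k(1)]] act_inv[OF k(1) dD] k(2)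
          by (simp add: image_subset_iff)
      qed
      then show "card {h \<in> G. act h d = y} = card {h \<in> G. act h d = d}"
        by (simp add: bij_betw_same_card)
    qed
    finally show ?thesis by simp
  qed
  have UN: "D = (\<Union>K\<in>S // rel. code ` K)"
    using Union_quotient[OF equiv] code by (metis image_Union image_image)
  have sum_D: "(\<Sum>d\<in>D. f d) = (\<Sum>K\<in>S // rel. \<Sum>d\<in>code ` K. f d)"
    unfolding UN
  proof (rule sum.UNION_disjoint[OF finq])
    show "\<forall>K\<in>S // rel. finite (code ` K)"
      using rep(2) code fin(2) by (metis finite_subset image_mono)
    show "\<forall>K\<in>S // rel. \<forall>K'\<in>S // rel. K \<noteq> K' \<longrightarrow> code ` K \<inter> code ` K' = {}"
      using disj by blast
  qed
  show ?thesis
    unfolding classes sum_D sum_divide_distrib[of _ "S // rel"]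
  proof (rule sum.cong[OF refl])
    fix K assume K: "K \<in> S // rel"
    let ?d = "code (representative K)"
    have d: "?d \<in> D" using rep[OF K] code by auto
    have "(\<Sum>d\<in>code ` K. f d) = (\<Sum>d\<in>code ` K. f ?d)"
      using orbit[OF K] f d by (intro sum.cong) auto
    moreover have "card G \<noteq> 0" using fin G(1) by auto
    ultimately show "f ?d / of_nat (card {h \<in> G. act h ?d = ?d}) = (\<Sum>d\<in>code ` K. f d) / of_nat (card G)"
      unfolding orbit_stabiliser[OF K refl] by (auto simp: field_simps)
  qed
qed

section \<open>Relabelling pearl chains\<close>

definition colour_perms :: "'v set \<Rightarrow> 'v set \<Rightarrow> ('v \<Rightarrow> 'v) set" where
  "colour_perms W B = {f. f permutes (W \<union> B) \<and> f ` W = W \<and> f ` B = B}"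

lemma colour_isos_eq: "colour_isos W B E E' = {f \<in> colour_perms W B. map_prod f f ` E = E'}"
  by (auto simp: colour_isos_def colour_perms_def)

lemma aut_group_eq: "aut_group W B E = {f \<in> colour_perms W B. map_prod f f ` E = E}"
  by (simp add: aut_group_def colour_isos_eq)

lemma finite_colour_perms: "finite W \<Longrightarrow> finite B \<Longrightarrow> finite (colour_perms W B)"
  by (rule finite_subset[of _ "{f. f permutes (W \<union> B)}"])
     (auto simp: colour_perms_def finite_permutations)

lemma id_colour_perm: "id \<in> colour_perms W B"
  by (auto simp: colour_perms_def permutes_id)

lemma comp_colour_perm:
  assumes "f \<in> colour_perms W B" "h \<in> colour_perms W B"
  shows "f \<circ> h \<in> colour_perms W B"
proof -
  have "(f \<circ> h) ` A = f ` h ` A" for A by (simp only: image_comp)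
  then show ?thesis
    using assms unfolding colour_perms_def mem_Collect_eq by (metis permutes_compose)
qed

lemma bij_colour_perm: "f \<in> colour_perms W B \<Longrightarrow> bij f"
  by (auto simp: colour_perms_def permutes_bij)

lemma inv_colour_perm:
  assumes "f \<in> colour_perms W B"
  shows "inv f \<in> colour_perms W B"
proof -
  have inv_f: "inv f ` f ` A = A" for A
    using bij_colour_perm[OF assms] by (simp add: image_comp bij_is_inj)
  show ?thesis
    using assms inv_f[of W] inv_f[of B] by (simp add: colour_perms_def permutes_inv)
qed

lemma colour_perm_mem:
  assumes "f \<in> colour_perms W B"
  shows "f x \<in> W \<longleftrightarrow> x \<in> W" "f x \<in> B \<longleftrightarrow> x \<in> B"
  using assms bij_colour_perm[OF assms] unfolding colour_perms_def
  by (metis (mono_tags, lifting) bij_is_inj inj_image_mem_iff mem_Collect_eq)+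

lemma inj_map_prod: "bij f \<Longrightarrow> inj_on (map_prod f f) E"
  by (auto simp: inj_on_def bij_def inj_def)

lemma reachable_map_prod:
  assumes "(x, y) \<in> (E \<union> E\<inverse>)\<^sup>*"
  shows "(f x, f y) \<in> (map_prod f f ` E \<union> (map_prod f f ` E)\<inverse>)\<^sup>*"
  using assms
proof induction
  case (step y z)
  then have "(f y, f z) \<in> map_prod f f ` E \<union> (map_prod f f ` E)\<inverse>"
    using map_prod_imageI[of _ _ E f f] by blast
  with step.IH show ?case by (rule rtrancl_into_rtrancl)
qed simp

lemma pearl_chain_map_prod:
  assumes f: "f \<in> colour_perms W B" and E: "pearl_chain d2 g W B E"
  shows "pearl_chain d2 g W B (map_prod f f ` E)"
proof -
  note bij = bij_colour_perm[OF f]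
  have "map_prod f f ` E \<subseteq> W \<times> B"
    using E colour_perm_mem[OF f] unfolding pearl_chain_def by auto
  moreover have "card {e \<in> map_prod f f ` E. snd e = b} = 2" if "b \<in> B" for b
  proof -
    have "{e \<in> map_prod f f ` E. snd e = b} = map_prod f f ` {e \<in> E. snd e = inv f b}"
      using bij by (force simp: bij_is_inj inv_f_f bij_is_surj surj_f_inv_f)
    moreover have "inv f b \<in> B" using colour_perm_mem[OF inv_colour_perm[OF f]] that by auto
    ultimately show ?thesis using E by (simp add: card_image inj_map_prod[OF bij] pearl_chain_def)
  qed
  moreover have "(x, y) \<in> (map_prod f f ` E \<union> (map_prod f f ` E)\<inverse>)\<^sup>*"
    if "x \<in> W \<union> B" "y \<in> W \<union> B" for x y
  proof -
    have "inv f x \<in> W \<union> B" "inv f y \<in> W \<union> B"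
      using colour_perm_mem[OF inv_colour_perm[OF f]] that by auto
    then have "(inv f x, inv f y) \<in> (E \<union> E\<inverse>)\<^sup>*" using E unfolding pearl_chain_def by blast
    from reachable_map_prod[OF this, of f] show ?thesis
      using bij by (simp add: bij_is_surj surj_f_inv_f)
  qed
  ultimately show ?thesis
    using E unfolding pearl_chain_def by (simp add: card_image inj_map_prod[OF bij])
qed

lemma finite_pearl_chains: "finite {E. pearl_chain d2 g W B E}"
proof (cases "finite W \<and> finite B")
  case True
  then have "finite (Pow (W \<times> B))" by simp
  moreover have "{E. pearl_chain d2 g W B E} \<subseteq> Pow (W \<times> B)" by (auto simp: pearl_chain_def)
  ultimately show ?thesis by (rule rev_finite_subset)
next
  case False
  then have "{E. pearl_chain d2 g W B E} = {}" by (auto simp: pearl_chain_def)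
  then show ?thesis by simp
qed

lemma finite_whites_blacks [simp]: "finite (whites d2)" "finite (blacks d2 g)" "finite (vertices d2 g)"
  by (simp_all add: whites_def blacks_def vertices_def)

text \<open>
  The automorphism group of a pearl chain is its stabiliser under relabelling of the vertices.
\<close>

lemma sum_over_pearl_chain_classes:
  fixes F :: "(nat \<times> nat) set \<Rightarrow> rat"
  assumes "\<And>f E. f \<in> colour_perms (whites d2) (blacks d2 g) \<Longrightarrow>
      pearl_chain d2 g (whites d2) (blacks d2 g) E \<Longrightarrow> F (map_prod f f ` E) = F E"
  shows "(\<Sum>K\<in>pearl_chain_classes d2 g.
            F (representative K) / of_nat (card (aut_group (whites d2) (blacks d2 g) (representative K)))) =
         (\<Sum>E\<in>{E. pearl_chain d2 g (whites d2) (blacks d2 g) E}. F E) /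
           of_nat (card (colour_perms (whites d2) (blacks d2 g)))"
    (is "_ = (\<Sum>E\<in>?P. F E) / of_nat (card ?G)")
  unfolding pearl_chain_classes_def aut_group_eq
proof (rule sum_over_isomorphism_classes[where code = "\<lambda>E. E" and f = F
      and act = "\<lambda>f E. map_prod f f ` E" and G = ?G and D = ?P and S = ?P
      and R = "\<lambda>E E'. colour_isos (whites d2) (blacks d2 g) E E' \<noteq> {}"])
  show "finite ?G" by (rule finite_colour_perms) simp_all
  show "finite ?P" by (rule finite_pearl_chains)
  show "id \<in> ?G" by (rule id_colour_perm)
  show "h \<circ> k \<in> ?G" if "h \<in> ?G" "k \<in> ?G" for h k using that by (rule comp_colour_perm)
  show "bij h" "inv h \<in> ?G" if "h \<in> ?G" for h
    using that by (rule bij_colour_perm, rule inv_colour_perm)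
  show "map_prod h h ` E \<in> ?P" "F (map_prod h h ` E) = F E" if "h \<in> ?G" "E \<in> ?P" for h E
    using pearl_chain_map_prod[of h _ _ d2 g E] assms[of h E] that by blast+
  show "map_prod id id ` E = E" for E :: "(nat \<times> nat) set"
    by (simp add: prod.map_id0)
  show "map_prod (h \<circ> k) (h \<circ> k) ` E = map_prod h h ` map_prod k k ` E"
    for h k :: "nat \<Rightarrow> nat" and E
    by (simp only: image_comp map_prod.comp)
  show "colour_isos (whites d2) (blacks d2 g) E E' \<noteq> {} \<longleftrightarrow> (\<exists>f\<in>?G. map_prod f f ` E = E')" for E E'
    unfolding colour_isos_eq by blast
  show "(\<lambda>E. E) ` ?P = ?P" by (rule image_ident)
qed

section \<open>Feynman integrals as sums over flows\<close>

text \<open>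
  For each edge the signed slope \<open>s\<close>, positive if the edge follows the orientation of the circle on its
  way from the white to the black end, and the number \<open>m\<close> of passages over the base point.
\<close>

type_synonym 'v flow = "'v \<times> 'v \<Rightarrow> int \<times> nat"

text \<open>
  Flow into a vertex minus flow out of it, where negative flow counts in the opposite direction.
  This is the leaking of the corresponding cover.
\<close>

definition excess :: "('v \<times> 'v) set \<Rightarrow> 'v flow \<Rightarrow> 'v \<Rightarrow> int" where
  "excess E z x = (\<Sum>e\<in>E. fst (z e) * (of_bool (x = snd e) - of_bool (x = fst e)))"

text \<open>
  An edge that does not pass over the base point stays on the arc between its end points, so its
  direction is forced. An edge that passes over it may run either way.
\<close>

definition admissible :: "('v \<Rightarrow> nat) \<Rightarrow> 'v \<times> 'v \<Rightarrow> int \<times> nat \<Rightarrow> bool" where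
  "admissible pos e sm \<longleftrightarrow> fst sm \<noteq> 0 \<and>
     (snd sm = 0 \<longrightarrow> 0 < fst sm * (int (pos (snd e)) - int (pos (fst e))))"

definition flow_degree :: "('v \<times> 'v) set \<Rightarrow> 'v flow \<Rightarrow> nat" where
  "flow_degree E z = (\<Sum>e\<in>E. nat \<bar>fst (z e)\<bar> * snd (z e))"

definition flow_weight :: "('v \<times> 'v) set \<Rightarrow> 'v flow \<Rightarrow> nat" where
  "flow_weight E z = (\<Prod>e\<in>E. nat \<bar>fst (z e)\<bar>)"

definition flows :: "('v \<Rightarrow> nat) \<Rightarrow> ('v \<times> 'v) set \<Rightarrow> nat \<Rightarrow> 'v flow set" where
  "flows pos E n = {z \<in> extensional E. (\<forall>e\<in>E. admissible pos e (z e)) \<and> flow_degree E z = n}"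

definition placements :: "'v set \<Rightarrow> ('v \<Rightarrow> nat) set" where
  "placements V = {pos \<in> extensional V. bij_betw pos V {1..card V}}"

text \<open>
  Cut the circle at the base point and just behind the first of the two ends of \<open>e\<close>. Edges without
  passage over the base point can cross the cut only forwards; the backward flow across the cut is carried by
  edges with a passage, hence is at most the degree \<open>n\<close>. The difference of the two is determined by the
  total excess of the vertices before the cut.
\<close>

lemma flow_cut_bound:
  assumes E: "finite E" "E \<subseteq> V \<times> V" and V: "finite V"
    and z: "z \<in> flows pos E n" and e: "e \<in> E" and "snd (z e) = 0"
  shows "\<bar>fst (z e)\<bar> \<le> int n + (\<Sum>x\<in>V. \<bar>excess E z x\<bar>)"
proof -
  \<comment> \<open>The vertices up to the first end of \<open>e\<close>; \<open>t\<close> is the contribution of an edge to their total excess.\<close>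
  define U where "U = {x \<in> V. pos x \<le> min (pos (fst e)) (pos (snd e))}"
  define t where "t = (\<lambda>e. fst (z e) * (of_bool (snd e \<in> U) - of_bool (fst e \<in> U)))"
  have fin: "finite U" using V by (simp add: U_def)
  have ind: "(\<Sum>x\<in>U. of_bool (x = y) :: int) = of_bool (y \<in> U)" for y
    using fin by (simp add: of_bool_def)
  have flux: "(\<Sum>x\<in>U. excess E z x) = (\<Sum>e\<in>E. t e)"
    unfolding excess_def t_def by (subst sum.swap) (simp add: sum_distrib_left[symmetric] sum_subtractf ind)
  have le: "t e' \<le> int (nat \<bar>fst (z e')\<bar> * snd (z e'))" if "e' \<in> E" for e'
  proof (cases "snd (z e') = 0")
    case True
    then have "0 < fst (z e') * (int (pos (snd e')) - int (pos (fst e')))"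
      using z that by (auto simp: flows_def admissible_def)
    then show ?thesis
      using True E(2) that by (auto simp: t_def U_def zero_less_mult_iff of_bool_def)
  next
    case False
    have "t e' \<le> \<bar>fst (z e')\<bar> * 1" unfolding t_def by (auto simp: of_bool_def)
    also have "\<dots> \<le> \<bar>fst (z e')\<bar> * int (snd (z e'))"
      using False by (intro mult_left_mono) auto
    finally show ?thesis by simp
  qed
  have "0 < fst (z e) * (int (pos (snd e)) - int (pos (fst e)))"
    using z e assms(6) by (auto simp: flows_def admissible_def)
  then have te: "t e = - \<bar>fst (z e)\<bar>"
    using E(2) e by (auto simp: t_def U_def zero_less_mult_iff of_bool_def)
  have "(\<Sum>e'\<in>E. t e') = t e + (\<Sum>e'\<in>E - {e}. t e')"
    using E(1) e by (rule sum.remove)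
  also have "\<dots> \<le> t e + (\<Sum>e'\<in>E - {e}. int (nat \<bar>fst (z e')\<bar> * snd (z e')))"
    using le by (intro add_left_mono sum_mono) auto
  also have "\<dots> = t e + int n"
    using z sum.remove[OF E(1) e, of "\<lambda>e'. int (nat \<bar>fst (z e')\<bar> * snd (z e'))"] assms(6)
    by (auto simp: flows_def flow_degree_def)
  finally have "\<bar>fst (z e)\<bar> \<le> int n - (\<Sum>x\<in>U. excess E z x)"
    using flux te by simp
  moreover have "\<bar>\<Sum>x\<in>U. excess E z x\<bar> \<le> (\<Sum>x\<in>V. \<bar>excess E z x\<bar>)"
    using sum_abs[of "excess E z" U] sum_mono2[OF V, of U "\<lambda>x. \<bar>excess E z x\<bar>"]
    by (auto simp: U_def intro: order_trans)
  ultimately show ?thesis by linarith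
qed

lemma finite_flows:
  assumes E: "finite E" "E \<subseteq> V \<times> V" and V: "finite V"
  shows "finite {z \<in> flows pos E n. excess E z = v}"
proof -
  define M where "M = int n + (\<Sum>x\<in>V. \<bar>v x\<bar>)"
  have M: "int n \<le> M" by (simp add: M_def sum_nonneg)
  have "{z \<in> flows pos E n. excess E z = v} \<subseteq> (\<Pi>\<^sub>E e\<in>E. {- M..M} \<times> {..n})"
  proof (intro subsetI PiE_I)
    fix z e assume z: "z \<in> {z \<in> flows pos E n. excess E z = v}" and e: "e \<in> E"
    have "nat \<bar>fst (z e)\<bar> * snd (z e) \<le> n"
      using z E(1) e member_le_sum[of e E "\<lambda>e. nat \<bar>fst (z e)\<bar> * snd (z e)"]
      by (auto simp: flows_def flow_degree_def)
    moreover have "nat \<bar>fst (z e)\<bar> \<ge> 1" using z e by (auto simp: flows_def admissible_def)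
    ultimately have *: "snd (z e) \<le> n" "snd (z e) \<noteq> 0 \<Longrightarrow> nat \<bar>fst (z e)\<bar> \<le> n"
      by (metis mult_le_mono1 mult_1 order_trans, metis mult_le_mono2 mult.right_neutral order_trans less_one linorder_not_less)
    have "\<bar>fst (z e)\<bar> \<le> M"
    proof (cases "snd (z e) = 0")
      case True
      then show ?thesis using flow_cut_bound[OF E V _ e] z by (auto simp: M_def)
    qed (use * M in linarith)
    then show "z e \<in> {- M..M} \<times> {..n}" using * by (cases "z e") auto
  qed (auto simp: flows_def extensional_def)
  then show ?thesis by (rule finite_subset) (auto intro!: finite_PiE E)
qed

lemma propagator_pos:
  assumes "0 < n"
  shows "propagator a n = (if a \<noteq> 0 \<and> nat \<bar>a\<bar> dvd n then - of_int \<bar>a\<bar> else 0)"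
proof -
  have fin: "finite {d. d dvd n}" using assms by simp
  have "(\<Sum>d | d dvd n. of_nat d * (of_bool (a = int d) + of_bool (a = - int d)) :: rat) =
        (\<Sum>d | d dvd n. if nat \<bar>a\<bar> = d then of_nat d else 0)"
    using assms by (intro sum.cong) (auto simp: of_bool_def)
  also have "\<dots> = (if nat \<bar>a\<bar> dvd n then of_nat (nat \<bar>a\<bar>) else 0)"
    using fin by simp
  finally show ?thesis using assms by (auto simp: propagator_def)
qed

text \<open>
  The divisor \<open>\<bar>a\<bar>\<close> of the \<open>q\<close>-exponent is the expansion factor of an edge and the complementary divisor
  \<open>m\<close> is the number of its passages over the base point. The one-sided constant term of the propagator
  is the case \<open>m = 0\<close>.
\<close>

lemma propagator_nonzeroE:
  assumes "propagator a k \<noteq> 0"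
  obtains m where "a \<noteq> 0" "k = nat \<bar>a\<bar> * m" "m = 0 \<Longrightarrow> 0 < a"
proof (cases "k = 0")
  case True
  then show ?thesis using assms that[of 0] by (auto simp: propagator_def split: if_splits)
next
  case False
  then have "a \<noteq> 0" "nat \<bar>a\<bar> dvd k" using assms by (auto simp: propagator_pos split: if_splits)
  then obtain m where "k = nat \<bar>a\<bar> * m" by (metis dvdE)
  then show ?thesis using False \<open>a \<noteq> 0\<close> that[of m] by auto
qed

lemma propagator_eq:
  assumes "a \<noteq> 0" "m = 0 \<Longrightarrow> 0 < a"
  shows "propagator a (nat \<bar>a\<bar> * m) = - of_int \<bar>a\<bar>"
proof (cases "m = 0")
  case True
  then show ?thesis using assms by (auto simp: propagator_def)
next
  case False
  then show ?thesis using assms by (simp add: propagator_pos)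
qed

definition edge_monomial :: "int \<Rightarrow> 'v \<times> 'v \<Rightarrow> 'v \<Rightarrow> int" where
  "edge_monomial s e = (\<lambda>x. s * (of_bool (x = snd e) - of_bool (x = fst e)))"

text \<open>
  The \<open>q\<close>-constant term of \<open>P(x\<^sub>u/x\<^sub>v, q)\<close>, for \<open>u\<close> before \<open>v\<close>, has positive exponents at \<open>u\<close>, so flow
  is gained at the smaller vertex. An edge that avoids the base point loses flow at the vertex that
  comes first on the circle. Hence the order in the integral is opposite to the one on the circle.
\<close>

definition decreasing_order :: "'v set \<Rightarrow> ('v \<Rightarrow> nat) \<Rightarrow> ('v \<times> 'v) set" where
  "decreasing_order V pos = {(x, y). x \<in> V \<and> y \<in> V \<and> pos y \<le> pos x}"

text \<open>
  Both branches of \<open>edge_factor\<close> yield the same monomials; the exponent at the black end decides in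
  either case, up to the sign in the propagator that the order of the two ends introduces.
\<close>

lemma edge_factor_eq:
  assumes "e \<in> V \<times> V" "fst e \<noteq> snd e" "inj_on pos V"
  shows "edge_factor (decreasing_order V pos) e \<mu> k =
     (if \<mu> = edge_monomial (\<mu> (snd e)) e
      then propagator (if pos (snd e) < pos (fst e) then - \<mu> (snd e) else \<mu> (snd e)) k else 0)"
proof -
  obtain w b where e: "e = (w, b)" by (metis surj_pair)
  have ne: "w \<noteq> b" "pos w \<noteq> pos b" using assms by (auto simp: e inj_on_def)
  have mono: "\<mu> = edge_monomial (\<mu> b) (w, b) \<longleftrightarrow> \<mu> w = - \<mu> b \<and> (\<forall>x. x \<noteq> w \<and> x \<noteq> b \<longrightarrow> \<mu> x = 0)"
    using ne by (auto simp: edge_monomial_def fun_eq_iff of_bool_def)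
  show ?thesis
    using assms(1) ne mono unfolding e
    by (auto simp: edge_factor_def decreasing_order_def propagator_at_def)
qed

lemma edge_factor_nonzeroE:
  assumes "e \<in> V \<times> V" "fst e \<noteq> snd e" "inj_on pos V"
    and "edge_factor (decreasing_order V pos) e \<mu> k \<noteq> 0"
  obtains s m where "admissible pos e (s, m)" "\<mu> = edge_monomial s e" "k = nat \<bar>s\<bar> * m"
proof -
  have ne: "pos (fst e) \<noteq> pos (snd e)"
    using assms(1,2) inj_on_eq_iff[OF assms(3)] by (simp add: mem_Times_iff)
  define a where "a = (if pos (snd e) < pos (fst e) then - \<mu> (snd e) else \<mu> (snd e))"
  from assms(4) have mu: "\<mu> = edge_monomial (\<mu> (snd e)) e" and nz: "propagator a k \<noteq> 0"
    using edge_factor_eq[OF assms(1-3), of \<mu> k] by (auto simp: a_def split: if_splits)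
  obtain m where m: "a \<noteq> 0" "k = nat \<bar>a\<bar> * m" "m = 0 \<Longrightarrow> 0 < a"
    using propagator_nonzeroE[OF nz] by metis
  then have "admissible pos e (\<mu> (snd e), m)" "k = nat \<bar>\<mu> (snd e)\<bar> * m"
    using ne by (auto simp: a_def admissible_def zero_less_mult_iff split: if_splits)
  with mu show ?thesis by (metis that)
qed

lemma edge_factor_monomial:
  assumes "e \<in> V \<times> V" "fst e \<noteq> snd e" "inj_on pos V" and "admissible pos e (s, m)"
  shows "edge_factor (decreasing_order V pos) e (edge_monomial s e) (nat \<bar>s\<bar> * m) = - of_int \<bar>s\<bar>"
proof -
  have "edge_monomial s e (snd e) = s" using assms(2) by (simp add: edge_monomial_def)
  then show ?thesis
    using edge_factor_eq[OF assms(1-3), of "edge_monomial s e" "nat \<bar>s\<bar> * m"] assms(4)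
      propagator_eq[of s m] propagator_eq[of "- s" m]
    by (auto simp: admissible_def zero_less_mult_iff)
qed

text \<open>
  Choosing a nonzero monomial in each edge factor is the same as choosing a flow: the
  monomials multiply to \<open>x\<^sup>v\<close> iff the excess is \<open>v\<close>, and the coefficient is the product of the \<open>- \<bar>s\<bar>\<close>,
  whose signs cancel.
\<close>

lemma series_prod_edge_factors:
  assumes E: "finite E" "E \<subseteq> V \<times> V" "\<And>e. e \<in> E \<Longrightarrow> fst e \<noteq> snd e" and even: "even (card E)"
    and V: "finite V" and pos: "inj_on pos V"
  shows "series_prod E (edge_factor (decreasing_order V pos)) v n =
     (\<Sum>z | z \<in> flows pos E n \<and> excess E z = v. of_nat (flow_weight E z))"
proof -
  let ?r = "decreasing_order V pos"
  define Z where "Z = {z. z \<in> flows pos E n \<and> excess E z = v}"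
  define \<Gamma> where "\<Gamma> = (\<lambda>z. \<lambda>e\<in>E. (edge_monomial (fst (z e)) e, nat \<bar>fst (z e)\<bar> * snd (z e)))"
  define g where "g = (\<lambda>c. if c \<in> extensional E \<and> (\<forall>x. (\<Sum>k\<in>E. fst (c k) x) = v x) \<and> (\<Sum>k\<in>E. snd (c k)) = n
                  then \<Prod>k\<in>E. edge_factor ?r k (fst (c k)) (snd (c k)) else 0)"
  have finZ: "finite Z" unfolding Z_def by (rule finite_flows[OF E(1,2) V])
  have mem_iff: "\<Gamma> z \<in> extensional E \<and> (\<forall>x. (\<Sum>k\<in>E. fst (\<Gamma> z k) x) = v x) \<and> (\<Sum>k\<in>E. snd (\<Gamma> z k)) = n \<longleftrightarrow>
      excess E z = v \<and> flow_degree E z = n" for z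
    by (auto simp: \<Gamma>_def excess_def flow_degree_def edge_monomial_def fun_eq_iff cong: sum.cong)
  have weight: "g (\<Gamma> z) = of_nat (flow_weight E z)" if "z \<in> Z" for z
  proof -
    have "g (\<Gamma> z) = (\<Prod>k\<in>E. edge_factor ?r k (fst (\<Gamma> z k)) (snd (\<Gamma> z k)))"
      using that mem_iff[of z] unfolding g_def Z_def flows_def by auto
    also have "\<dots> = (\<Prod>k\<in>E. - of_int \<bar>fst (z k)\<bar>)"
    proof (rule prod.cong[OF refl])
      fix k assume k: "k \<in> E"
      then have "admissible pos k (fst (z k), snd (z k))" using that by (auto simp: Z_def flows_def)
      from edge_factor_monomial[OF _ _ pos this] k E
      show "edge_factor ?r k (fst (\<Gamma> z k)) (snd (\<Gamma> z k)) = - of_int \<bar>fst (z k)\<bar>"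
        by (auto simp: \<Gamma>_def)
    qed
    also have "\<dots> = (\<Prod>k\<in>E. of_int \<bar>fst (z k)\<bar>)"
      using even by (simp add: prod_uminus)
    also have "\<dots> = of_nat (flow_weight E z)" by (simp add: flow_weight_def)
    finally show ?thesis .
  qed
  have inj: "inj_on \<Gamma> Z"
  proof (rule inj_onI, rule ext)
    fix z z' e assume z: "z \<in> Z" "z' \<in> Z" and eq: "\<Gamma> z = \<Gamma> z'"
    show "z e = z' e"
    proof (cases "e \<in> E")
      case True
      have "fst (\<Gamma> z e) (snd e) = fst (\<Gamma> z' e) (snd e)" "snd (\<Gamma> z e) = snd (\<Gamma> z' e)"
        using eq by simp_all
      then have "fst (z e) = fst (z' e)" "nat \<bar>fst (z e)\<bar> * snd (z e) = nat \<bar>fst (z' e)\<bar> * snd (z' e)"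
        using True E(3)[OF True] by (auto simp: \<Gamma>_def edge_monomial_def)
      moreover have "fst (z e) \<noteq> 0" using z True by (auto simp: Z_def flows_def admissible_def)
      ultimately show ?thesis by (simp add: prod_eq_iff)
    next
      case False
      then show ?thesis using z by (simp add: Z_def flows_def extensional_arb[of _ E])
    qed
  qed
  have supp: "{c. g c \<noteq> 0} \<subseteq> \<Gamma> ` Z"
  proof
    fix c assume "c \<in> {c. g c \<noteq> 0}"
    then have c: "c \<in> extensional E" "\<And>x. (\<Sum>k\<in>E. fst (c k) x) = v x" "(\<Sum>k\<in>E. snd (c k)) = n"
      "(\<Prod>k\<in>E. edge_factor ?r k (fst (c k)) (snd (c k))) \<noteq> 0"
      by (auto simp: g_def split: if_splits)
    have "\<exists>sm. admissible pos e sm \<and> c e = (edge_monomial (fst sm) e, nat \<bar>fst sm\<bar> * snd sm)" if e: "e \<in> E" for e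
    proof -
      have "edge_factor ?r e (fst (c e)) (snd (c e)) \<noteq> 0" using c(4) E(1) e by auto
      then obtain s m where "admissible pos e (s, m)" "fst (c e) = edge_monomial s e" "snd (c e) = nat \<bar>s\<bar> * m"
        using edge_factor_nonzeroE[OF _ _ pos] E e by blast
      then show ?thesis by (intro exI[of _ "(s, m)"]) (simp add: prod_eq_iff)
    qed
    then obtain z where z: "\<And>e. e \<in> E \<Longrightarrow> admissible pos e (z e) \<and>
        c e = (edge_monomial (fst (z e)) e, nat \<bar>fst (z e)\<bar> * snd (z e))"
      by metis
    have \<Gamma>: "\<Gamma> (restrict z E) = c"
      using z c(1) by (auto simp: \<Gamma>_def fun_eq_iff extensional_def)
    have "restrict z E \<in> Z"
      using mem_iff[of "restrict z E"] z c(1-3) unfolding \<Gamma> Z_def flows_def by auto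
    with \<Gamma> show "c \<in> \<Gamma> ` Z" by blast
  qed
  have "series_prod E (edge_factor ?r) v n = Sum_any g"
    by (simp add: series_prod_def g_def)
  also have "\<dots> = (\<Sum>c\<in>\<Gamma> ` Z. g c)"
    using finZ supp by (intro Sum_any.expand_superset) auto
  also have "\<dots> = (\<Sum>z\<in>Z. of_nat (flow_weight E z))"
    using inj weight by (simp add: sum.reindex)
  finally show ?thesis unfolding Z_def .
qed

text \<open>
  A placement is recovered from its order: the position of a vertex is the number of vertices that are
  not below it, because the order is reversed.
\<close>

lemma bij_betw_decreasing_order:
  assumes V: "finite V"
  shows "bij_betw (decreasing_order V) (placements V) {r. linear_order_on V r}"
proof (rule bij_betw_byWitness[of _ "\<lambda>r. \<lambda>x\<in>V. card {y \<in> V. (x, y) \<in> r}"])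
  show "\<forall>pos\<in>placements V. (\<lambda>x\<in>V. card {y \<in> V. (x, y) \<in> decreasing_order V pos}) = pos"
  proof (intro ballI ext)
    fix pos x assume pos: "pos \<in> placements V"
    show "(\<lambda>x\<in>V. card {y \<in> V. (x, y) \<in> decreasing_order V pos}) x = pos x"
    proof (cases "x \<in> V")
      case True
      have bij: "bij_betw pos V {1..card V}" using pos by (simp add: placements_def)
      then have px: "pos x \<in> {1..card V}" using True by (auto simp: bij_betw_def)
      have "pos ` {y \<in> V. pos y \<le> pos x} = {i \<in> pos ` V. i \<le> pos x}" by auto
      also have "\<dots> = {1..pos x}" using px bij by (auto simp: bij_betw_def)
      finally have im: "pos ` {y \<in> V. pos y \<le> pos x} = {1..pos x}" .
      have "inj_on pos {y \<in> V. pos y \<le> pos x}"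
        using bij by (auto simp: bij_betw_def intro: inj_on_subset)
      from card_image[OF this] have "card {y \<in> V. pos y \<le> pos x} = pos x" unfolding im by simp
      then show ?thesis using True by (simp add: decreasing_order_def)
    next
      case False
      then show ?thesis using pos by (simp add: placements_def extensional_def)
    qed
  qed
next
  have key: "card {z \<in> V. (y, z) \<in> r} \<le> card {z \<in> V. (x, z) \<in> r} \<longleftrightarrow> (x, y) \<in> r"
    if r: "linear_order_on V r" and xy: "x \<in> V" "y \<in> V" for r x y
  proof
    assume "(x, y) \<in> r"
    then show "card {z \<in> V. (y, z) \<in> r} \<le> card {z \<in> V. (x, z) \<in> r}"
      using r V by (intro card_mono) (auto simp: order_on_defs elim: transE)
  next
    assume le: "card {z \<in> V. (y, z) \<in> r} \<le> card {z \<in> V. (x, z) \<in> r}"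
    show "(x, y) \<in> r"
    proof (rule ccontr)
      assume "(x, y) \<notin> r"
      moreover have refl: "(x, x) \<in> r" "(y, y) \<in> r" using r xy by (auto simp: order_on_defs refl_on_def)
      ultimately have yx: "(y, x) \<in> r" using r xy by (auto simp: order_on_defs total_on_def)
      have "{z \<in> V. (x, z) \<in> r} \<subset> {z \<in> V. (y, z) \<in> r}"
        using yx r xy refl \<open>(x, y) \<notin> r\<close> by (auto simp: order_on_defs elim: transE)
      then have "card {z \<in> V. (x, z) \<in> r} < card {z \<in> V. (y, z) \<in> r}"
        using V by (intro psubset_card_mono) auto
      with le show False by simp
    qed
  qed
  show "\<forall>r\<in>{r. linear_order_on V r}. decreasing_order V (\<lambda>x\<in>V. card {y \<in> V. (x, y) \<in> r}) = r"
  proof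
    fix r assume "r \<in> {r. linear_order_on V r}"
    then have r: "linear_order_on V r" by simp
    then have "r \<subseteq> V \<times> V" by (simp add: order_on_defs)
    then show "decreasing_order V (\<lambda>x\<in>V. card {y \<in> V. (x, y) \<in> r}) = r"
      using key[OF r] by (auto simp: decreasing_order_def)
  qed
  show "(\<lambda>r. \<lambda>x\<in>V. card {y \<in> V. (x, y) \<in> r}) ` {r. linear_order_on V r} \<subseteq> placements V"
  proof
    fix pos assume "pos \<in> (\<lambda>r. \<lambda>x\<in>V. card {y \<in> V. (x, y) \<in> r}) ` {r. linear_order_on V r}"
    then obtain r where r: "linear_order_on V r" and pos: "pos = (\<lambda>x\<in>V. card {y \<in> V. (x, y) \<in> r})"
      by blast
    have inj: "inj_on pos V"
    proof (rule inj_onI)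
      fix x y assume "x \<in> V" "y \<in> V" "pos x = pos y"
      then have "(x, y) \<in> r" "(y, x) \<in> r"
        using key[OF r, of x y] key[OF r, of y x] by (simp_all add: pos)
      then show "x = y" using r by (auto simp: order_on_defs antisym_def)
    qed
    have "pos x \<in> {1..card V}" if "x \<in> V" for x
    proof -
      have "x \<in> {y \<in> V. (x, y) \<in> r}" using r that by (auto simp: order_on_defs refl_on_def)
      then have "card {y \<in> V. (x, y) \<in> r} > 0" using V by (auto simp: card_gt_0_iff)
      moreover have "card {y \<in> V. (x, y) \<in> r} \<le> card V" using V by (intro card_mono) auto
      ultimately show ?thesis using that by (simp add: pos)
    qed
    then have "pos ` V = {1..card V}"
      using card_image[OF inj] by (intro card_subset_eq) auto
    then show "pos \<in> placements V" using inj by (simp add: placements_def bij_betw_def pos)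
  qed
next
  show "decreasing_order V ` placements V \<subseteq> {r. linear_order_on V r}"
    by (auto simp: placements_def decreasing_order_def order_on_defs refl_on_def total_on_def
        bij_betw_def inj_on_def intro!: transI antisymI)
qed

lemma finite_leak_vectors: "finite W \<Longrightarrow> finite (leak_vectors W \<Delta>)"
  by (rule finite_subset[OF _ finite_set_of_finite_funs[of W "set_mset \<Delta>" 0]])
     (auto simp: leak_vectors_def)

lemma finite_placements:
  assumes "finite V"
  shows "finite (placements V)"
proof (rule finite_subset)
  show "placements V \<subseteq> (V \<rightarrow>\<^sub>E {1..card V})"
    by (auto simp: placements_def bij_betw_def PiE_def)
  show "finite (V \<rightarrow>\<^sub>E {1..card V})" using assms by (simp add: finite_PiE)
qed

lemma finite_leaking_flows:
  assumes "finite E" "E \<subseteq> V \<times> V" "finite V" "finite W"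
  shows "finite {z \<in> flows pos E n. excess E z \<in> leak_vectors W \<Delta>}"
proof -
  have "{z \<in> flows pos E n. excess E z \<in> leak_vectors W \<Delta>} =
      (\<Union>v\<in>leak_vectors W \<Delta>. {z \<in> flows pos E n. excess E z = v})" by auto
  then show ?thesis using finite_leak_vectors[OF assms(4)] finite_flows[OF assms(1-3)] by simp
qed

lemma sum_feynman_integrals_nth:
  assumes E: "finite E" "E \<subseteq> V \<times> V" "\<And>e. e \<in> E \<Longrightarrow> fst e \<noteq> snd e" "even (card E)"
    and V: "finite V" and W: "finite W"
  shows "fps_nth (\<Sum>v\<in>leak_vectors W \<Delta>. \<Sum>r | linear_order_on V r. feynman_integral E r v) n =
     (\<Sum>pos\<in>placements V. \<Sum>z\<in>{z \<in> flows pos E n. excess E z \<in> leak_vectors W \<Delta>}.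
        of_nat (flow_weight E z))"
proof -
  have "(\<Sum>r | linear_order_on V r. series_prod E (edge_factor r) v n) =
      (\<Sum>pos\<in>placements V. \<Sum>z | z \<in> flows pos E n \<and> excess E z = v. of_nat (flow_weight E z))" for v
  proof -
    have "(\<Sum>r | linear_order_on V r. series_prod E (edge_factor r) v n) =
        (\<Sum>pos\<in>placements V. series_prod E (edge_factor (decreasing_order V pos)) v n)"
      using sum.reindex_bij_betw[OF bij_betw_decreasing_order[OF V]] by (rule sym)
    also have "\<dots> = (\<Sum>pos\<in>placements V. \<Sum>z | z \<in> flows pos E n \<and> excess E z = v. of_nat (flow_weight E z))"
      by (intro sum.cong refl series_prod_edge_factors E V) (auto simp: placements_def bij_betw_def)
    finally show ?thesis .
  qed
  then have "fps_nth (\<Sum>v\<in>leak_vectors W \<Delta>. \<Sum>r | linear_order_on V r. feynman_integral E r v) n =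
     (\<Sum>v\<in>leak_vectors W \<Delta>. \<Sum>pos\<in>placements V. \<Sum>z | z \<in> flows pos E n \<and> excess E z = v.
        of_nat (flow_weight E z))"
    by (simp add: fps_sum_nth feynman_integral_def)
  also have "\<dots> = (\<Sum>pos\<in>placements V. \<Sum>v\<in>leak_vectors W \<Delta>. \<Sum>z | z \<in> flows pos E n \<and> excess E z = v.
        of_nat (flow_weight E z))"
    by (rule sum.swap)
  also have "\<dots> = (\<Sum>pos\<in>placements V. \<Sum>z\<in>{z \<in> flows pos E n. excess E z \<in> leak_vectors W \<Delta>}.
        of_nat (flow_weight E z))"
  proof (rule sum.cong[OF refl])
    fix pos
    let ?S = "{z \<in> flows pos E n. excess E z \<in> leak_vectors W \<Delta>}"
    have "(\<Sum>v\<in>leak_vectors W \<Delta>. \<Sum>z | z \<in> flows pos E n \<and> excess E z = v. of_nat (flow_weight E z)) =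
        (\<Sum>v\<in>leak_vectors W \<Delta>. \<Sum>z | z \<in> ?S \<and> excess E z = v. of_nat (flow_weight E z) :: rat)"
      by (intro sum.cong refl) auto
    also have "\<dots> = (\<Sum>z\<in>?S. of_nat (flow_weight E z))"
      using finite_leaking_flows[OF E(1,2) V W] finite_leak_vectors[OF W]
      by (intro sum.group) auto
    finally show "(\<Sum>v\<in>leak_vectors W \<Delta>. \<Sum>z | z \<in> flows pos E n \<and> excess E z = v. of_nat (flow_weight E z)) =
      (\<Sum>z\<in>?S. of_nat (flow_weight E z) :: rat)" .
  qed
  finally show ?thesis .
qed

section \<open>Covers as diagrams\<close>

lemma int_multiple_less_iff:
  fixes l x :: real
  assumes "0 < x" "x < l"
  shows "of_int j * l < x \<longleftrightarrow> j \<le> 0" "x < of_int j * l \<longleftrightarrow> 1 \<le> j"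
proof -
  have "of_int j * l \<le> 0" if "j \<le> 0"
    using that assms by (simp add: mult_nonpos_nonneg)
  moreover have "l \<le> of_int j * l" if "1 \<le> j"
    using mult_right_mono[of 1 "of_int j" l] that assms by simp
  ultimately show "of_int j * l < x \<longleftrightarrow> j \<le> 0" "x < of_int j * l \<longleftrightarrow> 1 \<le> j"
    using assms by (smt (verit))+
qed

lemma rmod_eq_iff_int_multiple:
  assumes "0 \<le> c" "c < l"
  shows "x rmod l = c \<longleftrightarrow> (\<exists>k. x = c + of_int k * l)"
proof
  assume "x rmod l = c"
  then have "[c = x] (rmod l)" using assms by (simp add: rcong_def)
  then show "\<exists>k. x = c + of_int k * l" by (simp add: rcong_altdef)
next
  assume "\<exists>k. x = c + of_int k * l"
  then show "x rmod l = c" using assms by (auto intro: rmod_unique)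
qed

text \<open>
  Here \<open>c\<close> is the base point and \<open>a\<close>, \<open>b\<close> are the images of the ends of an edge of length \<open>L\<close>. In the
  universal cover the edge is a segment from \<open>a\<close> to \<open>b + k * l\<close> for some integer \<open>k\<close>, and the lifts of
  \<open>c\<close> strictly inside this segment are \<open>c + l, \<dots>, c + k * l\<close> if the edge runs forwards and
  \<open>c + (k + 1) * l, \<dots>, c\<close> if it runs backwards. So \<open>\<bar>k\<bar>\<close> counts the passages over \<open>c\<close>.
\<close>

lemma winding_number_eq_card_crossings:
  fixes c a b l L :: real and s :: int
  assumes c: "0 \<le> c" "c < a" "a < l" "c < b" "b < l"
    and s: "s \<noteq> 0" and L: "0 < L" and ab: "(a + of_int s * L) rmod l = b"
  defines "T \<equiv> {t. 0 < t \<and> t < L \<and> (a + of_int s * t) rmod l = c}"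
  shows "finite T" "of_int s * L = b - a + of_int (sgn s) * of_nat (card T) * l"
proof -
  obtain k where k: "a + of_int s * L = b + of_int k * l"
    using ab c by (subst (asm) rmod_eq_iff_int_multiple) auto
  \<comment> \<open>\<open>h j\<close> is the time at which the lifted edge meets the lift \<open>c + j * l\<close> of \<open>c\<close>.\<close>
  define h where "h = (\<lambda>j :: int. (c - a + of_int j * l) / of_int s)"
  define J where "J = (if 0 < s then {1..k} else {k + 1..0})"
  have lpos: "0 < l" using c by simp
  have range: "0 < h j \<and> h j < L \<longleftrightarrow> j \<in> J" for j
  proof -
    note less = int_multiple_less_iff[of "a - c" l j] int_multiple_less_iff[of "b - c" l "j - k"]
    have sL: "of_int s * L = b - a + of_int k * l" using k by simp
    have shift: "0 < c - a + of_int j * l \<longleftrightarrow> a - c < of_int j * l"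
      "c - a + of_int j * l < 0 \<longleftrightarrow> of_int j * l < a - c"
      "c - a + of_int j * l < of_int s * L \<longleftrightarrow> of_int (j - k) * l < b - c"
      "of_int s * L < c - a + of_int j * l \<longleftrightarrow> b - c < of_int (j - k) * l"
      unfolding sL of_int_diff left_diff_distrib by auto
    show ?thesis
    proof (cases "0 < s")
      case True
      have "0 < h j \<longleftrightarrow> 1 \<le> j"
        using True less(2) c shift(1) by (simp add: h_def zero_less_divide_iff)
      moreover have "h j < L \<longleftrightarrow> j - k \<le> 0"
        using True less(3) c shift(3) by (simp add: h_def pos_divide_less_eq mult.commute)
      ultimately show ?thesis using True by (auto simp: J_def)
    next
      case False
      then have neg: "s < 0" using s by simp
      have "0 < h j \<longleftrightarrow> j \<le> 0"
        using neg less(1) c shift(2) by (simp add: h_def zero_less_divide_iff)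
      moreover have "h j < L \<longleftrightarrow> 1 \<le> j - k"
        using neg less(4) c shift(4) by (simp add: h_def neg_divide_less_eq mult.commute)
      ultimately show ?thesis using False by (auto simp: J_def)
    qed
  qed
  have T: "T = h ` J"
  proof (intro equalityI subsetI)
    fix t assume "t \<in> T"
    then obtain j where "a + of_int s * t = c + of_int j * l" "0 < t" "t < L"
      using c by (auto simp: T_def rmod_eq_iff_int_multiple)
    then have "t = h j" using s by (simp add: h_def field_simps)
    then show "t \<in> h ` J" using range[of j] \<open>0 < t\<close> \<open>t < L\<close> by blast
  next
    fix t assume "t \<in> h ` J"
    then obtain j where j: "j \<in> J" "t = h j" by blast
    then have "a + of_int s * t = c + of_int j * l" using s by (simp add: h_def)
    then show "t \<in> T" using range[of j] j c by (auto simp: T_def rmod_eq_iff_int_multiple)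
  qed
  show "finite T" by (simp add: T J_def)
  have "inj_on h J" using s lpos by (auto simp: inj_on_def h_def)
  then have card: "card T = card J" by (simp add: T card_image)
  have "sgn s * int (card J) = k"
  proof (cases "0 < s")
    case True
    then have "0 < of_int s * L" using L by simp
    then have "of_int (- k) * l < b - c" using k c by simp
    then have "0 \<le> k" using c int_multiple_less_iff(1)[of "b - c" l "- k"] by simp
    then show ?thesis using True by (simp add: J_def)
  next
    case False
    have "of_int s * L < 0" using False s L by (simp add: mult_less_0_iff)
    then have "of_int k * l < a - c" using k c by simp
    then have "k \<le> 0" using c int_multiple_less_iff(1)[of "a - c" l k] by simp
    then show ?thesis using False s by (simp add: J_def)
  qed
  then have "of_int k = of_int (sgn s) * (of_nat (card T) :: real)"
    unfolding card by (metis of_int_mult of_int_of_nat_eq)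
  with k show "of_int s * L = b - a + of_int (sgn s) * of_nat (card T) * l" by simp
qed

text \<open>
  Two slopes agree modulo \<open>l\<close> after any short time \<open>t\<close>. If \<open>t\<close> is small enough, no multiple of \<open>l\<close> other
  than \<open>0\<close> can account for the difference.
\<close>

lemma has_slope_unique:
  assumes "has_slope l C e s" "has_slope l C e s'" "0 < len C e" "0 < l"
  shows "s = s'"
proof (rule ccontr)
  assume "s \<noteq> s'"
  define D where "D = \<bar>of_int s - of_int s' :: real\<bar>"
  have D: "0 < D" using \<open>s \<noteq> s'\<close> by (simp add: D_def)
  \<comment> \<open>The bound \<open>l / (2 * D)\<close> keeps the two candidate images less than \<open>l\<close> apart.\<close>
  define t where "t = min (len C e / 2) (l / (2 * D))"
  have t: "0 < t" "t < len C e" using assms D by (auto simp: t_def min_def)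
  let ?a = "proj C (Vertex (fst e))"
  have "[?a + of_int s * t = ?a + of_int s' * t] (rmod l)"
    using assms(1,2) t by (auto simp: has_slope_def rcong_def)
  moreover have "\<bar>(?a + of_int s * t) - (?a + of_int s' * t)\<bar> < \<bar>l\<bar>"
  proof -
    have "D * t \<le> D * (l / (2 * D))" using D by (intro mult_left_mono) (auto simp: t_def)
    also have "\<dots> < l" using D assms(4) by simp
    finally have "D * t < l" .
    moreover have "\<bar>(?a + of_int s * t) - (?a + of_int s' * t)\<bar> = D * t"
      using t by (simp add: D_def abs_mult left_diff_distrib[symmetric])
    ultimately show ?thesis using assms(4) by simp
  qed
  ultimately have "?a + of_int s * t = ?a + of_int s' * t" by (rule rcong_imp_eq)
  then show False using t \<open>s \<noteq> s'\<close> by simp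
qed

lemma slope_eqI: "has_slope l C e s \<Longrightarrow> 0 < len C e \<Longrightarrow> 0 < l \<Longrightarrow> slope l C e = s"
  unfolding slope_def using has_slope_unique by (metis the_equality)

lemma leaking_eq_excess:
  assumes "finite (edges C)" "\<And>e. e \<in> edges C \<Longrightarrow> fst e \<noteq> snd e"
    and "\<And>e. e \<in> edges C \<Longrightarrow> slope l C e = fst (z e)" "\<And>e. e \<in> edges C \<Longrightarrow> fst (z e) \<noteq> 0"
  shows "leaking l C v = excess (edges C) z v"
  unfolding leaking_def excess_def local_degree.simps of_nat_sum sum.inter_filter[OF assms(1)]
    sum_subtractf[symmetric]
  using assms(2-4) by (intro sum.cong refl) (auto simp: flag_image_def expansion_def)

text \<open>
  An edge set, the positions of the vertices on the circle, and a flow on the edges.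
\<close>

type_synonym 'v diagram = "('v \<times> 'v) set \<times> ('v \<Rightarrow> nat) \<times> 'v flow"

definition diagrams :: "nat \<Rightarrow> nat \<Rightarrow> int multiset \<Rightarrow> nat \<Rightarrow> nat diagram set" where
  "diagrams d2 g \<Delta> n =
     (SIGMA E:{E. pearl_chain d2 g (whites d2) (blacks d2 g) E}. SIGMA pos:placements (vertices d2 g).
        {z \<in> flows pos E n. excess E z \<in> leak_vectors (whites d2) \<Delta>})"

fun diagram_weight :: "'v diagram \<Rightarrow> nat" where
  "diagram_weight (E, pos, z) = flow_weight E z"

locale marked_circle =
  fixes d2 g :: nat and l :: real and p :: "nat \<Rightarrow> real"
  assumes d2_pos: "0 < d2"
    and base_nonneg: "0 \<le> p 0"
    and p_mono: "strict_mono_on {0..2 * d2 + g - 1} p"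
    and p_less: "p (2 * d2 + g - 1) < l"
begin

abbreviation "W \<equiv> whites d2"
abbreviation "B \<equiv> blacks d2 g"
abbreviation "V \<equiv> vertices d2 g"

lemma card_V: "card V = 2 * d2 + g - 1"
proof -
  have "V = {..<2 * d2 + g - 1}" using d2_pos by (auto simp: vertices_def whites_def blacks_def)
  then show ?thesis by simp
qed

lemma p_less_iff: "i \<in> {0..card V} \<Longrightarrow> j \<in> {0..card V} \<Longrightarrow> p i < p j \<longleftrightarrow> i < j"
  using strict_mono_on_less[OF p_mono] by (simp add: card_V)

lemma p_eq_iff: "i \<in> {0..card V} \<Longrightarrow> j \<in> {0..card V} \<Longrightarrow> p i = p j \<longleftrightarrow> i = j"
  using p_less_iff[of i j] p_less_iff[of j i] by (cases i j rule: linorder_cases) auto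

lemma p_bounds:
  assumes "i \<in> {1..card V}"
  shows "p 0 < p i" "p i < l" "0 \<le> p i"
proof -
  show "p 0 < p i" using assms p_less_iff[of 0 i] by auto
  then show "0 \<le> p i" using base_nonneg by simp
  show "p i < l" using assms p_less p_less_iff[of i "card V"] by (cases "i = card V") (auto simp: card_V)
qed

lemma l_pos: "0 < l"
proof -
  have "1 \<in> {1..card V}" using d2_pos by (simp add: card_V)
  from p_bounds[OF this] show ?thesis by simp
qed

text \<open>
  Only the restrictions to vertices and edges are recorded, so that covers which differ in junk values
  outside their points have the same code.
\<close>

definition cover_code :: "nat metric_cover \<Rightarrow> nat diagram" where
  "cover_code C = (edges C,
     \<lambda>v\<in>V. the_inv_into {1..card V} p (proj C (Vertex v)),
     \<lambda>e\<in>edges C. (slope l C e, card {t. 0 < t \<and> t < len C e \<and> proj C (Inner e t) = p 0}))"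

text \<open>
  The metric data that a diagram prescribes. Up to junk values it determines the cover; this makes
  it easier to handle than an equation for the code, which involves the choice of a slope and a count of
  preimages.
\<close>

fun realises :: "nat metric_cover \<Rightarrow> nat diagram \<Rightarrow> bool" where
  "realises C (E, pos, z) \<longleftrightarrow> edges C = E \<and> (\<forall>v\<in>V. proj C (Vertex v) = p (pos v)) \<and>
     (\<forall>e\<in>E. 0 < len C e \<and>
        of_int (fst (z e)) * len C e =
          p (pos (snd e)) - p (pos (fst e)) + of_int (sgn (fst (z e))) * of_nat (snd (z e)) * l \<and>
        (\<forall>t. 0 < t \<and> t < len C e \<longrightarrow>
           proj C (Inner e t) = (p (pos (fst e)) + of_int (fst (z e)) * t) rmod l))"

lemma placement_mem: "pos \<in> placements V \<Longrightarrow> v \<in> V \<Longrightarrow> pos v \<in> {1..card V}"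
  by (auto simp: placements_def bij_betw_def)

lemma pearl_chain_edge:
  assumes "pearl_chain d2 g W B E" "e \<in> E"
  shows "fst e \<in> V" "snd e \<in> V" "fst e \<noteq> snd e" "fst e \<in> W" "snd e \<in> B"
proof -
  have "e \<in> W \<times> B" "W \<inter> B = {}" using assms unfolding pearl_chain_def by auto
  then show "fst e \<in> V" "snd e \<in> V" "fst e \<noteq> snd e" "fst e \<in> W" "snd e \<in> B"
    unfolding vertices_def by auto
qed

lemma pearl_chain_finite: "pearl_chain d2 g W B E \<Longrightarrow> finite E"
  unfolding pearl_chain_def using rev_finite_subset[of "W \<times> B" E] by simp

text \<open>
  The degree is computed over \<open>p 0\<close>, where no vertex lies: each passage of an edge over \<open>p 0\<close> contributes
  the expansion factor of this edge.
\<close>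

lemma realised_diagram:
  assumes E: "pearl_chain d2 g W B E" and pos: "pos \<in> placements V"
    and z: "z \<in> extensional E" "\<And>e. e \<in> E \<Longrightarrow> fst (z e) \<noteq> 0"
    and C: "realises C (E, pos, z)"
  shows realised_has_slope: "e \<in> E \<Longrightarrow> has_slope l C e (fst (z e))"
    and realised_code: "cover_code C = (E, pos, z)"
    and realised_leaking: "leaking l C v = excess E z v"
    and realised_degree: "cover_degree l p d2 g C = flow_degree E z"
proof -
  define T where "T = (\<lambda>e. {t. 0 < t \<and> t < len C e \<and> proj C (Inner e t) = p 0})"
  have edges: "edges C = E" using C by simp
  have end_proj: "(p (pos (fst e)) + of_int (fst (z e)) * len C e) rmod l = p (pos (snd e))"
    if e: "e \<in> E" for e
  proof (rule rmod_unique)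
    show "p (pos (snd e)) \<in> {0..<\<bar>l\<bar>}"
      using p_bounds[OF placement_mem[OF pos pearl_chain_edge(2)[OF E e]]] l_pos by simp
    show "p (pos (fst e)) + of_int (fst (z e)) * len C e =
        p (pos (snd e)) + of_int (sgn (fst (z e)) * int (snd (z e))) * l"
      using C e by simp
  qed
  show slope: "has_slope l C e (fst (z e))" if e: "e \<in> E" for e
    using C e z(2)[OF e] end_proj[OF e] pearl_chain_edge(1,2)[OF E e] by (auto simp: has_slope_def)
  have slope_eq: "slope l C e = fst (z e)" if "e \<in> E" for e
    using slope_eqI[OF slope[OF that] _ l_pos] C that by simp
  have T: "finite (T e)" "card (T e) = snd (z e)" if e: "e \<in> E" for e
  proof -
    have T_eq: "T e = {t. 0 < t \<and> t < len C e \<and> (p (pos (fst e)) + of_int (fst (z e)) * t) rmod l = p 0}"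
      using C e by (auto simp: T_def)
    note fst_e = p_bounds[OF placement_mem[OF pos pearl_chain_edge(1)[OF E e]]]
    note snd_e = p_bounds[OF placement_mem[OF pos pearl_chain_edge(2)[OF E e]]]
    have len: "0 < len C e" using C e by simp
    note w = winding_number_eq_card_crossings[OF base_nonneg fst_e(1,2) snd_e(1,2) z(2)[OF e] len
        end_proj[OF e], folded T_eq]
    show "finite (T e)" by (rule w(1))
    have "of_int (fst (z e)) * len C e =
        p (pos (snd e)) - p (pos (fst e)) + of_int (sgn (fst (z e))) * of_nat (snd (z e)) * l"
      using C e by simp
    with w(2) have "of_int (sgn (fst (z e))) * real (card (T e)) * l = of_int (sgn (fst (z e))) * real (snd (z e)) * l"
      by linarith
    then show "card (T e) = snd (z e)" using l_pos z(2)[OF e] by (simp add: sgn_if split: if_splits)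
  qed
  have "(\<lambda>v\<in>V. the_inv_into {1..card V} p (proj C (Vertex v))) = pos"
  proof
    fix v
    show "(\<lambda>v\<in>V. the_inv_into {1..card V} p (proj C (Vertex v))) v = pos v"
    proof (cases "v \<in> V")
      case True
      have "inj_on p {1..card V}" using p_eq_iff by (auto simp: inj_on_def)
      from the_inv_into_f_f[OF this placement_mem[OF pos True]] show ?thesis using True C by simp
    next
      case False
      then show ?thesis using pos by (simp add: placements_def extensional_def)
    qed
  qed
  moreover have "(\<lambda>e\<in>edges C. (slope l C e, card (T e))) = z"
    using slope_eq T(2) z(1) by (auto simp: edges fun_eq_iff extensional_def)
  ultimately show "cover_code C = (E, pos, z)" by (simp add: cover_code_def edges T_def)
  show "leaking l C v = excess E z v" for v
    using leaking_eq_excess[of C l z v] pearl_chain_finite[OF E] pearl_chain_edge(3)[OF E] slope_eq z(2)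
    by (simp add: edges)
  have fibre: "{x. x \<in> points V C \<and> proj C x = p 0} = (\<lambda>(e, t). Inner e t) ` (SIGMA e:E. T e)"
  proof -
    have "proj C (Vertex v) \<noteq> p 0" if "v \<in> V" for v
      using C that p_bounds(1)[OF placement_mem[OF pos that]] by simp
    then show ?thesis by (auto simp: points_def edges T_def image_iff)
  qed
  have "cover_degree l p d2 g C = (\<Sum>(e, t)\<in>(SIGMA e:E. T e). local_degree l C (Inner e t) After)"
    unfolding cover_degree_def fibre_degree_def fibre
    by (subst sum.reindex) (auto simp: inj_on_def case_prod_unfold)
  also have "\<dots> = (\<Sum>e\<in>E. \<Sum>t\<in>T e. local_degree l C (Inner e t) After)"
    using pearl_chain_finite[OF E] T(1) by (subst sum.Sigma) auto
  also have "\<dots> = flow_degree E z"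
    unfolding flow_degree_def by (intro sum.cong refl) (simp add: T(2) slope_eq expansion_def)
  finally show "cover_degree l p d2 g C = flow_degree E z" .
qed

text \<open>
  The fibre condition gives an injection from the \<open>N\<close> marked points to the vertices. As there are \<open>N\<close>
  vertices, every vertex lies over exactly one marked point, which is its position.
\<close>

lemma curled_pearl_chain_code:
  assumes C: "curled_pearl_chain l p \<Delta> d2 g C"
  shows "realises C (cover_code C)" "cover_code C \<in> diagrams d2 g \<Delta> (cover_degree l p d2 g C)"
proof -
  define E where "E = edges C"
  define pos where "pos = (\<lambda>v\<in>V. the_inv_into {1..card V} p (proj C (Vertex v)))"
  define z where "z = (\<lambda>e\<in>E. (slope l C e, card {t. 0 < t \<and> t < len C e \<and> proj C (Inner e t) = p 0}))"
  have code: "cover_code C = (E, pos, z)" by (simp add: cover_code_def E_def pos_def z_def)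
  note C' = C[unfolded curled_pearl_chain_def card_V[symmetric], folded E_def]
  have E: "pearl_chain d2 g W B E" and len': "\<forall>e\<in>E. 0 < len C e"
    and slopes': "\<forall>e\<in>E. \<exists>s. has_slope l C e s"
    and fibres': "\<forall>i\<in>{1..card V}. \<exists>!v. v \<in> V \<and> proj C (Vertex v) = p i"
    and leak: "image_mset (leaking l C) (mset_set W) = \<Delta>" "\<forall>b\<in>B. leaking l C b = 0"
    using C' by - (elim conjE, assumption)+
  note len = bspec[OF len'] and slopes = bspec[OF slopes'] and fibres = bspec[OF fibres']
  have inj_p: "inj_on p {1..card V}" using p_eq_iff by (auto simp: inj_on_def)
  obtain u where u: "\<And>i. i \<in> {1..card V} \<Longrightarrow> u i \<in> V \<and> proj C (Vertex (u i)) = p i"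
    using fibres by metis
  have "inj_on u {1..card V}"
    using u inj_p by (metis (no_types, lifting) inj_on_def)
  then have "u ` {1..card V} = V"
    using u by (intro card_subset_eq) (auto simp: card_image)
  have u_pos: "pos v \<in> {1..card V} \<and> proj C (Vertex v) = p (pos v)" if v: "v \<in> V" for v
  proof -
    obtain i where "i \<in> {1..card V}" "v = u i" using \<open>u ` _ = V\<close> v by blast
    then show ?thesis using u v the_inv_into_f_f[OF inj_p, of i] by (simp add: pos_def)
  qed
  have pos: "pos \<in> placements V"
  proof -
    have "inj_on pos V"
      using u_pos fibres by (metis (no_types, lifting) inj_on_def)
    moreover have "pos ` V = {1..card V}"
    proof
      show "{1..card V} \<subseteq> pos ` V"
      proof
        fix i assume i: "i \<in> {1..card V}"
        have "pos (u i) = i" using u[OF i] u_pos[of "u i"] inj_onD[OF inj_p] i by metis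
        then show "i \<in> pos ` V" using u[OF i] by (metis imageI)
      qed
    qed (use u_pos in auto)
    ultimately show ?thesis by (simp add: placements_def bij_betw_def pos_def)
  qed
  have slope: "has_slope l C e (fst (z e))" if e: "e \<in> E" for e
    using slopes[OF e] slope_eqI[OF _ len[OF e] l_pos] e by (auto simp: z_def)
  have z: "z \<in> extensional E" "\<And>e. e \<in> E \<Longrightarrow> fst (z e) \<noteq> 0"
    using slope by (auto simp: z_def has_slope_def)
  have edge_len: "of_int (fst (z e)) * len C e =
      p (pos (snd e)) - p (pos (fst e)) + of_int (sgn (fst (z e))) * of_nat (snd (z e)) * l"
    and edge_proj: "\<And>t. 0 < t \<Longrightarrow> t < len C e \<Longrightarrow>
           proj C (Inner e t) = (p (pos (fst e)) + of_int (fst (z e)) * t) rmod l" if e: "e \<in> E" for e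
  proof -
    note mem = pearl_chain_edge(1,2)[OF E e]
    note fst_e = p_bounds[OF placement_mem[OF pos mem(1)]]
    note snd_e = p_bounds[OF placement_mem[OF pos mem(2)]]
    show inner: "proj C (Inner e t) = (p (pos (fst e)) + of_int (fst (z e)) * t) rmod l"
      if "0 < t" "t < len C e" for t
      using slope[OF e] that u_pos[OF mem(1)] by (simp add: has_slope_def)
    have end_proj: "(p (pos (fst e)) + of_int (fst (z e)) * len C e) rmod l = p (pos (snd e))"
      using slope[OF e] u_pos[OF mem(1)] u_pos[OF mem(2)] by (simp add: has_slope_def)
    have "snd (z e) = card {t. 0 < t \<and> t < len C e \<and> (p (pos (fst e)) + of_int (fst (z e)) * t) rmod l = p 0}"
      using inner e by (auto simp: z_def intro!: arg_cong[where f = card])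
    then show "of_int (fst (z e)) * len C e =
        p (pos (snd e)) - p (pos (fst e)) + of_int (sgn (fst (z e))) * of_nat (snd (z e)) * l"
      using winding_number_eq_card_crossings(2)[OF base_nonneg fst_e(1,2) snd_e(1,2) z(2)[OF e] len[OF e] end_proj]
      by simp
  qed
  have real: "realises C (E, pos, z)"
    using u_pos len edge_len edge_proj by (simp add: E_def)
  then show "realises C (cover_code C)" by (simp only: code)
  have admissible: "admissible pos e (z e)" if e: "e \<in> E" for e
    unfolding admissible_def
  proof (intro conjI impI z(2)[OF e])
    assume "snd (z e) = 0"
    then have eq: "of_int (fst (z e)) * len C e = p (pos (snd e)) - p (pos (fst e))"
      using edge_len[OF e] by simp
    have "pos (fst e) \<in> {0..card V}" "pos (snd e) \<in> {0..card V}"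
      using placement_mem[OF pos] pearl_chain_edge(1,2)[OF E e] by auto
    note less = p_less_iff[OF this] p_less_iff[OF this(2,1)]
    show "0 < fst (z e) * (int (pos (snd e)) - int (pos (fst e)))"
    proof (cases "0 < fst (z e)")
      case True
      then have "0 < of_int (fst (z e)) * len C e" using len[OF e] by simp
      then show ?thesis using eq less True by (simp add: zero_less_mult_iff)
    next
      case False
      then have neg: "fst (z e) < 0" using z(2)[OF e] by simp
      then have "of_int (fst (z e)) * len C e < 0" using len[OF e] by (simp add: mult_less_0_iff)
      then show ?thesis using eq less neg by (simp add: zero_less_mult_iff)
    qed
  qed
  note realised = realised_leaking[OF E pos z real] realised_degree[OF E pos z real]
  have "excess E z \<in> leak_vectors W \<Delta>"
    unfolding leak_vectors_def
  proof (intro CollectI conjI allI impI)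
    show "image_mset (excess E z) (mset_set W) = \<Delta>"
      using leak(1) realised(1) by (metis (no_types, lifting) ext)
    fix x assume x: "x \<notin> W"
    show "excess E z x = 0"
    proof (cases "x \<in> B")
      case True
      then show ?thesis using leak(2) realised(1) by metis
    next
      case False
      then show ?thesis
        unfolding excess_def using x pearl_chain_edge(4,5)[OF E] by (intro sum.neutral) auto
    qed
  qed
  then show "cover_code C \<in> diagrams d2 g \<Delta> (cover_degree l p d2 g C)"
    unfolding code diagrams_def using E pos z(1) admissible realised(2) by (auto simp: flows_def)
qed

definition cover_of :: "nat diagram \<Rightarrow> nat metric_cover" where
  "cover_of = (\<lambda>(E, pos, z). \<lparr>edges = E,
     len = (\<lambda>e. (p (pos (snd e)) - p (pos (fst e)) + of_int (sgn (fst (z e))) * of_nat (snd (z e)) * l) /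
              of_int (fst (z e))),
     proj = (\<lambda>x. case x of Vertex v \<Rightarrow> p (pos v)
              | Inner e t \<Rightarrow> (p (pos (fst e)) + of_int (fst (z e)) * t) rmod l)\<rparr>)"

text \<open>
  Two marked points are less than \<open>l\<close> apart, so a single passage over the base point already fixes the
  sign of the numerator.
\<close>

lemma edge_length_pos:
  assumes "i \<in> {1..card V}" "j \<in> {1..card V}" "s \<noteq> 0" "m = 0 \<Longrightarrow> 0 < s * (int j - int i)"
  shows "0 < (p j - p i + of_int (sgn s) * of_nat m * l) / of_int s"
proof (cases "m = 0")
  case True
  then show ?thesis
    using assms p_less_iff[of i j] p_less_iff[of j i]
    by (auto simp: zero_less_mult_iff zero_less_divide_iff)
next
  case False
  then have "l \<le> of_nat m * l" using l_pos mult_right_mono[of 1 "real m" l] by simp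
  moreover have "\<bar>p j - p i\<bar> < l"
    using p_bounds[OF assms(1)] p_bounds[OF assms(2)] by linarith
  ultimately show ?thesis using assms(3) by (auto simp: sgn_if zero_less_divide_iff)
qed

lemma diagram_realised:
  assumes d: "d \<in> diagrams d2 g \<Delta> n"
  shows "curled_pearl_chain l p \<Delta> d2 g (cover_of d)" "cover_degree l p d2 g (cover_of d) = n"
    "cover_code (cover_of d) = d"
proof -
  obtain E pos z where d_eq: "d = (E, pos, z)" by (metis prod_cases3)
  have E: "pearl_chain d2 g W B E" and pos: "pos \<in> placements V" and z: "z \<in> extensional E"
    and adm: "\<And>e. e \<in> E \<Longrightarrow> admissible pos e (z e)" and deg: "flow_degree E z = n"
    and leak: "excess E z \<in> leak_vectors W \<Delta>"
    using d by (auto simp: d_eq diagrams_def flows_def)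
  define C where "C = cover_of (E, pos, z)"
  have nz: "fst (z e) \<noteq> 0" if "e \<in> E" for e using adm[OF that] by (simp add: admissible_def)
  have len: "0 < len C e" if e: "e \<in> E" for e
    using edge_length_pos[OF placement_mem[OF pos pearl_chain_edge(1)[OF E e]]
        placement_mem[OF pos pearl_chain_edge(2)[OF E e]] nz[OF e], of "snd (z e)"] adm[OF e]
    by (simp add: C_def cover_of_def admissible_def)
  have real: "realises C (E, pos, z)"
    using len nz by (auto simp: C_def cover_of_def)
  note realised = realised_has_slope[OF E pos z nz real] realised_code[OF E pos z nz real]
    realised_leaking[OF E pos z nz real] realised_degree[OF E pos z nz real]
  have bij: "bij_betw pos V {1..card V}" using pos by (simp add: placements_def)
  have "curled_pearl_chain l p \<Delta> d2 g C"
    unfolding curled_pearl_chain_def card_V[symmetric]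
  proof (intro conjI ballI)
    show "pearl_chain d2 g W B (edges C)" using E by (simp add: C_def cover_of_def)
    show "0 < len C e" if "e \<in> edges C" for e
      using len that by (simp add: C_def cover_of_def)
    show "proj C ` points V C \<subseteq> {0..<l}"
      using p_bounds[OF placement_mem[OF pos]] l_pos rmod_less[OF l_pos] rmod_nonneg[of l]
      by (auto simp: points_def C_def cover_of_def)
    show "\<exists>s. has_slope l C e s" if "e \<in> edges C" for e
      using realised(1)[of e] that by (auto simp: C_def cover_of_def)
    show "\<exists>!v. v \<in> V \<and> proj C (Vertex v) = p i" if i: "i \<in> {1..card V}" for i
    proof -
      obtain v where v: "v \<in> V" "pos v = i"
        using bij_betw_imp_surj_on[OF bij] i by (metis imageE)
      have "proj C (Vertex w) = p i \<longleftrightarrow> w = v" if w: "w \<in> V" for w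
      proof -
        have "pos w \<in> {0..card V}" using placement_mem[OF pos w] by simp
        then have "p (pos w) = p i \<longleftrightarrow> pos w = i" using i by (intro p_eq_iff) auto
        then show ?thesis
          using v w inj_on_eq_iff[OF bij_betw_imp_inj_on[OF bij]] by (auto simp: C_def cover_of_def)
      qed
      then show ?thesis using v by blast
    qed
    show "image_mset (leaking l C) (mset_set W) = \<Delta>"
      using leak ext[of "leaking l C" "excess E z", OF realised(3)] by (simp add: leak_vectors_def)
    show "leaking l C b = 0" if "b \<in> B" for b
      using leak realised(3) that by (auto simp: leak_vectors_def whites_def blacks_def)
  qed
  then show "curled_pearl_chain l p \<Delta> d2 g (cover_of d)" by (simp add: C_def d_eq)
  show "cover_degree l p d2 g (cover_of d) = n" "cover_code (cover_of d) = d"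
    using realised(2,4) deg by (simp_all add: C_def d_eq)
qed

end

section \<open>Counting diagrams up to relabelling\<close>

fun relabel :: "nat set \<Rightarrow> (nat \<Rightarrow> nat) \<Rightarrow> nat diagram \<Rightarrow> nat diagram" where
  "relabel V f (E, pos, z) = (map_prod f f ` E, \<lambda>v\<in>V. pos (inv f v),
     \<lambda>e\<in>map_prod f f ` E. z (map_prod (inv f) (inv f) e))"

declare relabel.simps [simp del]

lemma finite_diagrams: "finite (diagrams d2 g \<Delta> n)"
  unfolding diagrams_def
proof (intro finite_SigmaI finite_pearl_chains finite_placements finite_leaking_flows)
  fix E assume "E \<in> {E. pearl_chain d2 g (whites d2) (blacks d2 g) E}"
  then have E: "E \<subseteq> whites d2 \<times> blacks d2 g" by (simp add: pearl_chain_def)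
  show "finite E" using E by (rule finite_subset) simp
  show "E \<subseteq> vertices d2 g \<times> vertices d2 g" using E by (auto simp: vertices_def)
qed simp_all

lemma relabel_id:
  assumes "d \<in> diagrams d2 g \<Delta> n"
  shows "relabel (vertices d2 g) id d = d"
  using assms
  by (auto simp: relabel.simps diagrams_def placements_def flows_def prod.map_id0 extensional_restrict)

lemma relabel_comp:
  assumes f: "f \<in> colour_perms (whites d2) (blacks d2 g)" and h: "h \<in> colour_perms (whites d2) (blacks d2 g)"
  shows "relabel (vertices d2 g) (f \<circ> h) d = relabel (vertices d2 g) f (relabel (vertices d2 g) h d)"
proof -
  obtain E pos z where d: "d = (E, pos, z)" by (metis prod_cases3)
  note bij = bij_colour_perm[OF f] bij_colour_perm[OF h]
  have inv_comp: "inv (f \<circ> h) = inv h \<circ> inv f" using bij by (simp add: o_inv_distrib)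
  have images: "map_prod (f \<circ> h) (f \<circ> h) ` E = map_prod f f ` map_prod h h ` E"
    by (simp only: image_comp map_prod.comp)
  have inv_mem: "inv f v \<in> vertices d2 g" if "v \<in> vertices d2 g" for v
    using colour_perm_mem[OF inv_colour_perm[OF f]] that by (auto simp: vertices_def)
  have inv_edge: "map_prod (inv f) (inv f) e \<in> map_prod h h ` E" if "e \<in> map_prod f f ` map_prod h h ` E" for e
    using that bij(1) by (auto simp: bij_is_inj inv_f_f)
  show ?thesis
    unfolding d relabel.simps images inv_comp prod.inject
  proof (intro conjI refl)
    show "(\<lambda>v\<in>vertices d2 g. pos ((inv h \<circ> inv f) v)) =
        (\<lambda>v\<in>vertices d2 g. (\<lambda>v\<in>vertices d2 g. pos (inv h v)) (inv f v))"
      using inv_mem by (intro restrict_ext) simp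
    show "(\<lambda>e\<in>map_prod f f ` map_prod h h ` E. z (map_prod (inv h \<circ> inv f) (inv h \<circ> inv f) e)) =
      (\<lambda>e\<in>map_prod f f ` map_prod h h ` E.
          (\<lambda>e\<in>map_prod h h ` E. z (map_prod (inv h) (inv h) e)) (map_prod (inv f) (inv f) e))"
      using inv_edge by (intro restrict_ext) (simp add: map_prod.comp[symmetric] del: map_prod.comp)
  qed
qed

lemma map_prod_inv:
  assumes "bij f"
  shows "map_prod (inv f) (inv f) (map_prod f f e) = e"
  using assms by (cases e) (simp add: bij_is_inj inv_f_f)

lemma sum_relabelled_edges:
  assumes "bij f"
  shows "(\<Sum>e\<in>map_prod f f ` E. F e) = (\<Sum>e\<in>E. F (map_prod f f e))"
  by (simp add: sum.reindex inj_map_prod[OF assms])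

lemma relabelled_edges:
  assumes "bij f" "relabel V f (E, pos, z) = (E', pos', z')"
  shows "E' = map_prod f f ` E" "e \<in> E \<Longrightarrow> z' (map_prod f f e) = z e"
  using assms(2) by (auto simp: relabel.simps map_prod_inv[OF assms(1)])

lemma excess_relabel:
  assumes "bij f" "relabel V f (E, pos, z) = (E', pos', z')"
  shows "excess E' z' x = excess E z (inv f x)"
proof -
  have inv_f: "x = f y \<longleftrightarrow> inv f x = y" for y
    using assms(1) by (metis bij_inv_eq_iff)
  show ?thesis
    unfolding excess_def relabelled_edges(1)[OF assms] sum_relabelled_edges[OF assms(1)]
    by (intro sum.cong refl) (simp add: relabelled_edges(2)[OF assms] inv_f)
qed

lemma flow_weight_relabel:
  assumes "bij f" "relabel V f (E, pos, z) = (E', pos', z')"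
  shows "flow_weight E' z' = flow_weight E z"
  unfolding flow_weight_def relabelled_edges(1)[OF assms] prod.reindex[OF inj_map_prod[OF assms(1)]]
  by (intro prod.cong refl) (simp add: relabelled_edges(2)[OF assms])

lemma flow_degree_relabel:
  assumes "bij f" "relabel V f (E, pos, z) = (E', pos', z')"
  shows "flow_degree E' z' = flow_degree E z"
  unfolding flow_degree_def relabelled_edges(1)[OF assms] sum_relabelled_edges[OF assms(1)]
  by (intro sum.cong refl) (simp add: relabelled_edges(2)[OF assms])

lemma diagram_weight_relabel:
  assumes "bij f"
  shows "diagram_weight (relabel V f d) = diagram_weight d"
proof -
  obtain E pos z where d: "d = (E, pos, z)" by (metis prod_cases3)
  obtain E' pos' z' where d': "relabel V f (E, pos, z) = (E', pos', z')" by (metis prod_cases3)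
  from flow_weight_relabel[OF assms d'] show ?thesis by (simp only: d d' diagram_weight.simps)
qed

lemma leak_vectors_comp:
  assumes f: "f \<in> colour_perms W B" and v: "v \<in> leak_vectors W \<Delta>"
  shows "v \<circ> f \<in> leak_vectors W \<Delta>"
proof -
  have "image_mset (v \<circ> f) (mset_set W) = image_mset v (image_mset f (mset_set W))"
    by (simp add: multiset.map_comp)
  also have "image_mset f (mset_set W) = mset_set (f ` W)"
    using bij_colour_perm[OF f] by (intro image_mset_mset_set) (auto simp: bij_def intro: inj_on_subset)
  also have "f ` W = W" using f by (simp add: colour_perms_def)
  finally have eq: "image_mset (v \<circ> f) (mset_set W) = image_mset v (mset_set W)" .
  show ?thesis
    using v colour_perm_mem(1)[OF f] unfolding leak_vectors_def mem_Collect_eq eq by simp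
qed

lemma relabel_diagram:
  assumes f: "f \<in> colour_perms (whites d2) (blacks d2 g)" and d: "d \<in> diagrams d2 g \<Delta> n"
  shows "relabel (vertices d2 g) f d \<in> diagrams d2 g \<Delta> n"
proof -
  obtain E pos z where d_eq: "d = (E, pos, z)" by (metis prod_cases3)
  obtain E' pos' z' where d': "relabel (vertices d2 g) f (E, pos, z) = (E', pos', z')" by (metis prod_cases3)
  note bij = bij_colour_perm[OF f] and f' = inv_colour_perm[OF f]
  have E: "pearl_chain d2 g (whites d2) (blacks d2 g) E" and pos: "pos \<in> placements (vertices d2 g)"
    and z: "z \<in> flows pos E n" and leak: "excess E z \<in> leak_vectors (whites d2) \<Delta>"
    using d by (auto simp: d_eq diagrams_def)
  have "pearl_chain d2 g (whites d2) (blacks d2 g) E'"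
    unfolding relabelled_edges(1)[OF bij d'] by (rule pearl_chain_map_prod[OF f E])
  moreover have "pos' \<in> placements (vertices d2 g)"
  proof -
    have "inv f permutes vertices d2 g" using f' by (simp add: colour_perms_def vertices_def)
    then have "bij_betw (pos \<circ> inv f) (vertices d2 g) {1..card (vertices d2 g)}"
      using pos by (auto simp: placements_def intro: bij_betw_trans permutes_imp_bij)
    then show ?thesis
      using d' by (auto simp: relabel.simps placements_def cong: bij_betw_cong)
  qed
  moreover have "z' \<in> flows pos' E' n"
    unfolding flows_def
  proof (intro CollectI conjI ballI)
    show "z' \<in> extensional E'" using d' by (auto simp: relabel.simps)
    show "flow_degree E' z' = n" using flow_degree_relabel[OF bij d'] z by (simp add: flows_def)
    fix e' assume "e' \<in> E'"
    then obtain e where e: "e \<in> E" "e' = map_prod f f e"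
      unfolding relabelled_edges(1)[OF bij d'] by (metis imageE)
    have "e \<in> whites d2 \<times> blacks d2 g" using E e(1) by (auto simp: pearl_chain_def)
    then have "f (fst e) \<in> vertices d2 g" "f (snd e) \<in> vertices d2 g"
      using colour_perm_mem[OF f] by (auto simp: vertices_def)
    then have "pos' (fst e') = pos (fst e)" "pos' (snd e') = pos (snd e)"
      using d' e bij by (auto simp: relabel.simps bij_is_inj inv_f_f)
    moreover have "z' e' = z e" using relabelled_edges(2)[OF bij d' e(1)] e(2) by simp
    moreover have "admissible pos e (z e)" using z e by (simp add: flows_def)
    ultimately show "admissible pos' e' (z' e')" by (simp add: admissible_def)
  qed
  moreover have "excess E' z' \<in> leak_vectors (whites d2) \<Delta>"
  proof -
    have "excess E' z' = excess E z \<circ> inv f" using excess_relabel[OF bij d'] by (simp add: fun_eq_iff)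
    then show ?thesis using leak_vectors_comp[OF f' leak] by simp
  qed
  ultimately show ?thesis unfolding d_eq d' by (simp add: diagrams_def)
qed

text \<open>
  The placement separates the vertices, so a permutation that respects it is trivial.
\<close>

lemma relabel_free:
  assumes f: "f \<in> colour_perms (whites d2) (blacks d2 g)" and d: "d \<in> diagrams d2 g \<Delta> n"
    and eq: "relabel (vertices d2 g) f d = d"
  shows "f = id"
proof
  fix x
  obtain E pos z where d_eq: "d = (E, pos, z)" by (metis prod_cases3)
  have inj: "inj_on pos (vertices d2 g)" using d by (auto simp: d_eq diagrams_def placements_def bij_betw_def)
  show "f x = id x"
  proof (cases "x \<in> vertices d2 g")
    case True
    then have fx: "f x \<in> vertices d2 g" using colour_perm_mem[OF f] by (auto simp: vertices_def)
    have "pos (f x) = pos (inv f (f x))"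
      using eq fx unfolding d_eq relabel.simps by (auto dest: fun_cong[of _ _ "f x"])
    then have "pos (f x) = pos x" using bij_colour_perm[OF f] by (simp add: bij_is_inj inv_f_f)
    then show ?thesis using inj_onD[OF inj] fx True by simp
  next
    case False
    then show ?thesis using f by (auto simp: colour_perms_def vertices_def permutes_def)
  qed
qed

context marked_circle
begin

lemma realises_relabel:
  assumes f: "f \<in> colour_perms W B" and E: "pearl_chain d2 g W B E"
    and C: "realises C (E, pos, z)"
    and edges: "edges C' = map_prod f f ` E"
    and len: "\<And>e. e \<in> E \<Longrightarrow> len C' (map_prod f f e) = len C e"
    and vertex: "\<And>v. v \<in> V \<Longrightarrow> proj C' (Vertex (f v)) = proj C (Vertex v)"
    and inner: "\<And>e t. e \<in> E \<Longrightarrow> 0 < t \<Longrightarrow> t < len C e \<Longrightarrow>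
       proj C' (Inner (map_prod f f e) t) = proj C (Inner e t)"
  shows "realises C' (relabel V f (E, pos, z))"
proof -
  note bij = bij_colour_perm[OF f]
  have fV: "f v \<in> V" if "v \<in> V" for v using colour_perm_mem[OF f] that by (auto simp: vertices_def)
  have invV: "inv f v \<in> V" "f (inv f v) = v" if "v \<in> V" for v
    using colour_perm_mem[OF inv_colour_perm[OF f]] that bij
    by (auto simp: vertices_def bij_is_surj surj_f_inv_f)
  have inv_f: "inv f (f v) = v" for v using bij by (simp add: bij_is_inj)
  show ?thesis
    unfolding relabel.simps realises.simps
  proof (intro conjI ballI)
    show "edges C' = map_prod f f ` E" by (rule edges)
    show "proj C' (Vertex v) = p ((\<lambda>v\<in>V. pos (inv f v)) v)" if v: "v \<in> V" for v
      using vertex[OF invV(1)[OF v]] invV[OF v] C v by simp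
    fix e' assume "e' \<in> map_prod f f ` E"
    then obtain e where e: "e \<in> E" "e' = map_prod f f e" by (metis imageE)
    note mem = fV[OF pearl_chain_edge(1)[OF E e(1)]] fV[OF pearl_chain_edge(2)[OF E e(1)]]
    have pos_eq: "(\<lambda>v\<in>V. pos (inv f v)) (fst e') = pos (fst e)" "(\<lambda>v\<in>V. pos (inv f v)) (snd e') = pos (snd e)"
      using mem e(2) inv_f by auto
    have z_eq: "(\<lambda>e\<in>map_prod f f ` E. z (map_prod (inv f) (inv f) e)) e' = z e"
      using e map_prod_inv[OF bij] by simp
    have len_eq: "len C' e' = len C e" using len[OF e(1)] e(2) by simp
    note Ce = C[unfolded realises.simps, THEN conjunct2, THEN conjunct2, rule_format, OF e(1)]
    show "0 < len C' e'" using Ce len_eq by simp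
    show "of_int (fst ((\<lambda>e\<in>map_prod f f ` E. z (map_prod (inv f) (inv f) e)) e')) * len C' e' =
      p ((\<lambda>v\<in>V. pos (inv f v)) (snd e')) - p ((\<lambda>v\<in>V. pos (inv f v)) (fst e')) +
      of_int (sgn (fst ((\<lambda>e\<in>map_prod f f ` E. z (map_prod (inv f) (inv f) e)) e'))) *
      of_nat (snd ((\<lambda>e\<in>map_prod f f ` E. z (map_prod (inv f) (inv f) e)) e')) * l"
      unfolding pos_eq z_eq len_eq using Ce by blast
    show "\<forall>t. 0 < t \<and> t < len C' e' \<longrightarrow>
         proj C' (Inner e' t) = (p ((\<lambda>v\<in>V. pos (inv f v)) (fst e')) +
           of_int (fst ((\<lambda>e\<in>map_prod f f ` E. z (map_prod (inv f) (inv f) e)) e')) * t) rmod l"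
      unfolding pos_eq z_eq len_eq using Ce inner[OF e(1)] e(2) by simp
  qed
qed

lemma realises_unique:
  assumes E: "pearl_chain d2 g W B E" and nz: "\<forall>e\<in>E. fst (z e) \<noteq> 0"
    and C: "realises C (E, pos, z)" and C': "realises C' (E, pos, z)"
  shows "edges C' = edges C" "\<And>e. e \<in> E \<Longrightarrow> len C' e = len C e"
    "\<And>v. v \<in> V \<Longrightarrow> proj C' (Vertex v) = proj C (Vertex v)"
    "\<And>e t. e \<in> E \<Longrightarrow> 0 < t \<Longrightarrow> t < len C e \<Longrightarrow> proj C' (Inner e t) = proj C (Inner e t)"
proof -
  show "edges C' = edges C" using C C' by simp
  show "proj C' (Vertex v) = proj C (Vertex v)" if "v \<in> V" for v using C C' that by simp
  show len: "len C' e = len C e" if e: "e \<in> E" for e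
  proof -
    have "of_int (fst (z e)) * len C' e = of_int (fst (z e)) * len C e" using C C' e by simp
    then show ?thesis using nz e by simp
  qed
  show "proj C' (Inner e t) = proj C (Inner e t)" if "e \<in> E" "0 < t" "t < len C e" for e t
    using C C' that len by simp
qed

text \<open>
  Isomorphic covers have related diagrams because an isomorphism transports the prescribed metric data.
  Conversely, transporting the metric of \<open>C\<close> along the permutation gives a cover that realises the
  diagram of \<open>C'\<close> and therefore agrees with \<open>C'\<close>.
\<close>

lemma cover_iso_iff:
  assumes C: "curled_pearl_chain l p \<Delta> d2 g C" and C': "curled_pearl_chain l p \<Delta> d2 g C'"
  shows "cover_iso d2 g C C' \<longleftrightarrow> (\<exists>f\<in>colour_perms W B. relabel V f (cover_code C) = cover_code C')"
proof -
  obtain E pos z where code: "cover_code C = (E, pos, z)" by (metis prod_cases3)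
  obtain E' pos' z' where code': "cover_code C' = (E', pos', z')" by (metis prod_cases3)
  note real = curled_pearl_chain_code[OF C, unfolded code]
  note real' = curled_pearl_chain_code[OF C', unfolded code']
  have E: "pearl_chain d2 g W B E" using real(2) by (simp add: diagrams_def)
  have E': "pearl_chain d2 g W B E'" using real'(2) by (simp add: diagrams_def)
  have edges: "edges C = E" "edges C' = E'" using real(1) real'(1) by simp_all
  show ?thesis
  proof
    assume "cover_iso d2 g C C'"
    then obtain f where f: "f \<in> colour_perms W B" and im: "map_prod f f ` E = E'"
      and iso: "\<forall>e\<in>E. len C' (map_prod f f e) = len C e"
        "\<forall>v\<in>V. proj C' (Vertex (f v)) = proj C (Vertex v)"
        "\<forall>e\<in>E. \<forall>t. 0 < t \<and> t < len C e \<longrightarrow> proj C' (Inner (map_prod f f e) t) = proj C (Inner e t)"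
      unfolding cover_iso_def colour_isos_eq edges by blast
    have "realises C' (relabel V f (E, pos, z))"
    proof (rule realises_relabel[OF f E real(1)])
      show "edges C' = map_prod f f ` E" using edges im by simp
    qed (use iso in blast)+
    moreover have "relabel V f (E, pos, z) \<in> diagrams d2 g \<Delta> (cover_degree l p d2 g C)"
      by (rule relabel_diagram[OF f real(2)])
    moreover obtain E2 pos2 z2 where eq: "relabel V f (E, pos, z) = (E2, pos2, z2)" by (metis prod_cases3)
    ultimately have "cover_code C' = relabel V f (E, pos, z)"
      unfolding eq by (intro realised_code) (auto simp: diagrams_def flows_def admissible_def)
    then show "\<exists>f\<in>colour_perms W B. relabel V f (cover_code C) = cover_code C'"
      using f code by auto
  next
    assume "\<exists>f\<in>colour_perms W B. relabel V f (cover_code C) = cover_code C'"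
    then obtain f where f: "f \<in> colour_perms W B" and eq: "relabel V f (E, pos, z) = (E', pos', z')"
      unfolding code code' by blast
    note bij = bij_colour_perm[OF f]
    \<comment> \<open>The cover \<open>C\<close> with its vertices renamed by \<open>f\<close>.\<close>
    define C2 where "C2 = \<lparr>edges = map_prod f f ` E, len = len C \<circ> map_prod (inv f) (inv f),
      proj = (\<lambda>x. case x of Vertex v \<Rightarrow> proj C (Vertex (inv f v))
                | Inner e t \<Rightarrow> proj C (Inner (map_prod (inv f) (inv f) e) t))\<rparr>"
    have C2: "edges C2 = map_prod f f ` E" "len C2 (map_prod f f e) = len C e"
        "proj C2 (Vertex (f v)) = proj C (Vertex v)" "proj C2 (Inner (map_prod f f e) t) = proj C (Inner e t)" for e v t
      using bij map_prod_inv[OF bij, of e] by (simp_all add: C2_def bij_is_inj)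
    have "realises C2 (E', pos', z')"
      unfolding eq[symmetric] by (rule realises_relabel[OF f E real(1)]) (rule C2)+
    have nz: "\<forall>e\<in>E'. fst (z' e) \<noteq> 0"
      using real'(2) by (auto simp: diagrams_def flows_def admissible_def)
    note uniq = realises_unique[OF E' nz \<open>realises C2 (E', pos', z')\<close> real'(1)]
    have im: "map_prod f f ` E = E'" using relabelled_edges(1)[OF bij eq] by simp
    have fV: "f v \<in> V" if "v \<in> V" for v using colour_perm_mem[OF f] that by (auto simp: vertices_def)
    have fE: "map_prod f f e \<in> E'" if "e \<in> E" for e using im that by blast
    show "cover_iso d2 g C C'"
      unfolding cover_iso_def colour_isos_eq edges
    proof (intro bexI[of _ f] conjI ballI allI impI)
      show "f \<in> {f \<in> colour_perms W B. map_prod f f ` E = E'}" using f im by simp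
      show "len C' (map_prod f f e) = len C e" if "e \<in> E" for e
        using uniq(2)[OF fE[OF that]] C2(2) by simp
      show "proj C' (Vertex (f v)) = proj C (Vertex v)" if "v \<in> V" for v
        using uniq(3)[OF fV[OF that]] C2(3) by simp
      show "proj C' (Inner (map_prod f f e) t) = proj C (Inner e t)"
        if "e \<in> E" "0 < t \<and> t < len C e" for e t
        using uniq(4)[OF fE[OF that(1)], of t] that C2(2,4) by simp
    qed
  qed
qed

lemma multiplicity_eq_weight: "multiplicity_of l C = diagram_weight (cover_code C)"
  by (simp add: multiplicity_of_def cover_code_def flow_weight_def expansion_def)

text \<open>
  Covers carry no automorphism factor: the action on diagrams is free, so every orbit has as many
  elements as the group.
\<close>

lemma N_pearl_eq_sum_diagrams:
  "(of_nat (N_pearl l p \<Delta> n d2 g) :: rat) =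
     (\<Sum>d\<in>diagrams d2 g \<Delta> n. of_nat (diagram_weight d)) / of_nat (card (colour_perms W B))"
proof -
  define S where "S = {C. curled_pearl_chain l p \<Delta> d2 g C \<and> cover_degree l p d2 g C = n}"
  let ?w = "\<lambda>d. of_nat (diagram_weight d) :: rat"
  let ?G = "colour_perms W B"
  let ?D = "diagrams d2 g \<Delta> n"
  have code: "cover_code ` S = ?D"
  proof (intro equalityI subsetI)
    fix d assume "d \<in> cover_code ` S"
    then show "d \<in> ?D" using curled_pearl_chain_code(2) by (auto simp: S_def)
  next
    fix d assume d: "d \<in> ?D"
    have "cover_of d \<in> S" using diagram_realised(1,2)[OF d] by (simp add: S_def)
    then show "d \<in> cover_code ` S" using diagram_realised(3)[OF d] by (metis imageI)
  qed
  have iso: "cover_iso d2 g C C' \<longleftrightarrow> (\<exists>f\<in>?G. relabel V f (cover_code C) = cover_code C')"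
    if "C \<in> S" "C' \<in> S" for C C'
    using that cover_iso_iff by (auto simp: S_def)
  have iso_refl: "cover_iso d2 g C C" if "C \<in> S" for C
    using iso[OF that that] id_colour_perm relabel_id[of "cover_code C"] code that by blast
  have stabiliser: "{f \<in> ?G. relabel V f d = d} = {id}" if "d \<in> ?D" for d
    using relabel_free[OF _ that] relabel_id[OF that] id_colour_perm by auto
  have "(of_nat (N_pearl l p \<Delta> n d2 g) :: rat) =
      (\<Sum>K\<in>iso_classes S (cover_iso d2 g). ?w (cover_code (representative K)))"
    by (simp add: N_pearl_def S_def multiplicity_eq_weight)
  also have "\<dots> = (\<Sum>K\<in>iso_classes S (cover_iso d2 g). ?w (cover_code (representative K)) /
      of_nat (card {f \<in> ?G. relabel V f (cover_code (representative K)) = cover_code (representative K)}))"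
  proof (rule sum.cong[OF refl])
    fix K assume "K \<in> iso_classes S (cover_iso d2 g)"
    then have "cover_code (representative K) \<in> ?D" using representative_mem iso_refl code by blast
    from stabiliser[OF this]
    show "?w (cover_code (representative K)) = ?w (cover_code (representative K)) /
      of_nat (card {f \<in> ?G. relabel V f (cover_code (representative K)) = cover_code (representative K)})"
      by simp
  qed
  also have "\<dots> = (\<Sum>d\<in>?D. ?w d) / of_nat (card ?G)"
  proof (rule sum_over_isomorphism_classes[where G = ?G and D = ?D and act = "relabel V" and f = ?w])
    show "finite ?G" by (rule finite_colour_perms) simp_all
    show "finite ?D" by (rule finite_diagrams)
    show "id \<in> ?G" by (rule id_colour_perm)
    show "h \<circ> k \<in> ?G" if "h \<in> ?G" "k \<in> ?G" for h k using that by (rule comp_colour_perm)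
    show "bij h" "inv h \<in> ?G" if "h \<in> ?G" for h
      using that by (rule bij_colour_perm, rule inv_colour_perm)
    show "relabel V h d \<in> ?D" if "h \<in> ?G" "d \<in> ?D" for h d using that by (rule relabel_diagram)
    show "relabel V id d = d" if "d \<in> ?D" for d using that by (rule relabel_id)
    show "relabel V (h \<circ> k) d = relabel V h (relabel V k d)" if "h \<in> ?G" "k \<in> ?G" for h k d
      using that by (rule relabel_comp)
    show "cover_code ` S = ?D" by (rule code)
    show "cover_iso d2 g C C' \<longleftrightarrow> (\<exists>f\<in>?G. relabel V f (cover_code C) = cover_code C')"
      if "C \<in> S" "C' \<in> S" for C C' using that by (rule iso)
    show "?w (relabel V h d) = ?w d" if "h \<in> ?G" for h d
      using diagram_weight_relabel[OF bij_colour_perm[OF that]] by simp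
  qed
  finally show ?thesis .
qed

end

definition chain_weight :: "nat \<Rightarrow> nat \<Rightarrow> int multiset \<Rightarrow> nat \<Rightarrow> (nat \<times> nat) set \<Rightarrow> rat" where
  "chain_weight d2 g \<Delta> n E = (\<Sum>d | d \<in> diagrams d2 g \<Delta> n \<and> fst d = E. of_nat (diagram_weight d))"

lemma chain_weight_map_prod:
  assumes f: "f \<in> colour_perms (whites d2) (blacks d2 g)"
  shows "chain_weight d2 g \<Delta> n (map_prod f f ` E) = chain_weight d2 g \<Delta> n E"
  unfolding chain_weight_def
proof (rule sum.reindex_bij_witness[where i = "relabel (vertices d2 g) f" and j = "relabel (vertices d2 g) (inv f)"])
  note f' = inv_colour_perm[OF f] and bij = bij_colour_perm[OF f]
  have fst_relabel: "fst (relabel V h d) = map_prod h h ` fst d" for V h d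
    by (cases d rule: prod_cases3) (simp add: relabel.simps)
  have inv_image: "map_prod (inv f) (inv f) ` map_prod f f ` E = E"
    by (simp add: image_image map_prod_inv[OF bij])
  have inverse: "f \<circ> inv f = id" "inv f \<circ> f = id"
    using bij by (auto simp: fun_eq_iff bij_is_inj bij_is_surj surj_f_inv_f)
  fix d
  show "relabel (vertices d2 g) f (relabel (vertices d2 g) (inv f) d) = d"
    "relabel (vertices d2 g) (inv f) d \<in> {d. d \<in> diagrams d2 g \<Delta> n \<and> fst d = E}"
    "of_nat (diagram_weight (relabel (vertices d2 g) (inv f) d)) = (of_nat (diagram_weight d) :: rat)"
    if "d \<in> {d. d \<in> diagrams d2 g \<Delta> n \<and> fst d = map_prod f f ` E}"
  proof -
    have d: "d \<in> diagrams d2 g \<Delta> n" "fst d = map_prod f f ` E" using that by blast+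
    show "relabel (vertices d2 g) f (relabel (vertices d2 g) (inv f) d) = d"
      unfolding relabel_comp[OF f f', symmetric] inverse by (rule relabel_id[OF d(1)])
    show "relabel (vertices d2 g) (inv f) d \<in> {d. d \<in> diagrams d2 g \<Delta> n \<and> fst d = E}"
      using relabel_diagram[OF f' d(1)] d(2) by (simp add: fst_relabel inv_image)
    show "of_nat (diagram_weight (relabel (vertices d2 g) (inv f) d)) = (of_nat (diagram_weight d) :: rat)"
      by (simp only: diagram_weight_relabel[OF bij_colour_perm[OF f']])
  qed
  show "relabel (vertices d2 g) (inv f) (relabel (vertices d2 g) f d) = d"
    "relabel (vertices d2 g) f d \<in> {d. d \<in> diagrams d2 g \<Delta> n \<and> fst d = map_prod f f ` E}"
    if "d \<in> {d. d \<in> diagrams d2 g \<Delta> n \<and> fst d = E}"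
  proof -
    have d: "d \<in> diagrams d2 g \<Delta> n" "fst d = E" using that by blast+
    show "relabel (vertices d2 g) (inv f) (relabel (vertices d2 g) f d) = d"
      unfolding relabel_comp[OF f' f, symmetric] inverse by (rule relabel_id[OF d(1)])
    show "relabel (vertices d2 g) f d \<in> {d. d \<in> diagrams d2 g \<Delta> n \<and> fst d = map_prod f f ` E}"
      using relabel_diagram[OF f d(1)] d(2) by (simp add: fst_relabel)
  qed
qed

lemma sum_chain_weight:
  "(\<Sum>E\<in>{E. pearl_chain d2 g (whites d2) (blacks d2 g) E}. chain_weight d2 g \<Delta> n E) =
   (\<Sum>d\<in>diagrams d2 g \<Delta> n. of_nat (diagram_weight d))"
  unfolding chain_weight_def
  by (rule sum.group[OF finite_diagrams finite_pearl_chains]) (auto simp: diagrams_def)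

lemma chain_weight_eq_feynman:
  assumes E: "pearl_chain d2 g (whites d2) (blacks d2 g) E"
  shows "chain_weight d2 g \<Delta> n E = fps_nth (\<Sum>v\<in>leak_vectors (whites d2) \<Delta>.
           \<Sum>r | linear_order_on (vertices d2 g) r. feynman_integral E r v) n"
proof -
  let ?Q = "SIGMA pos:placements (vertices d2 g). {z \<in> flows pos E n. excess E z \<in> leak_vectors (whites d2) \<Delta>}"
  have sub: "E \<subseteq> whites d2 \<times> blacks d2 g" and disj: "whites d2 \<inter> blacks d2 g = {}"
    using E by (auto simp: pearl_chain_def)
  have fin: "finite E" using sub by (rule finite_subset) simp
  have sub': "E \<subseteq> vertices d2 g \<times> vertices d2 g" using sub by (auto simp: vertices_def)
  have ne: "fst e \<noteq> snd e" if "e \<in> E" for e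
    using sub disj that by (metis disjoint_iff mem_Times_iff subsetD)
  have even: "even (card E)"
  proof -
    have "snd ` E \<subseteq> blacks d2 g" using sub by auto
    \<comment> \<open>Every edge has exactly one black end, and every black vertex has two edges.\<close>
    then have "card E = (\<Sum>b\<in>blacks d2 g. card {e \<in> E. snd e = b})"
      using sum_fun_comp[of E "blacks d2 g" snd "\<lambda>_. 1::nat"] fin by simp
    also have "\<dots> = (\<Sum>b\<in>blacks d2 g. 2)" using E by (intro sum.cong) (auto simp: pearl_chain_def)
    finally show ?thesis by simp
  qed
  have "{d. d \<in> diagrams d2 g \<Delta> n \<and> fst d = E} = Pair E ` ?Q"
    using E by (auto simp: diagrams_def)
  then have "chain_weight d2 g \<Delta> n E = (\<Sum>q\<in>?Q. of_nat (diagram_weight (E, q)))"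
    unfolding chain_weight_def by (simp add: sum.reindex inj_on_def del: diagram_weight.simps)
  also have "\<dots> = (\<Sum>(pos, z)\<in>?Q. of_nat (flow_weight E z))"
    by (intro sum.cong) auto
  also have "\<dots> = (\<Sum>pos\<in>placements (vertices d2 g).
      \<Sum>z\<in>{z \<in> flows pos E n. excess E z \<in> leak_vectors (whites d2) \<Delta>}. of_nat (flow_weight E z))"
    using finite_placements[OF finite_whites_blacks(3)]
      finite_leaking_flows[OF fin sub' finite_whites_blacks(3) finite_whites_blacks(1)]
    by (intro sum.Sigma[symmetric] ballI) blast+
  also have "\<dots> = fps_nth (\<Sum>v\<in>leak_vectors (whites d2) \<Delta>.
           \<Sum>r | linear_order_on (vertices d2 g) r. feynman_integral E r v) n"
    by (rule sum_feynman_integrals_nth[symmetric])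
       (fact fin sub' ne even finite_whites_blacks(3) finite_whites_blacks(1))+
  finally show ?thesis .
qed

theorem theorem4p5:
  fixes d2 g :: nat and \<Delta> :: "int multiset" and l :: real and p :: "nat \<Rightarrow> real"
  assumes "0 < d2" and "0 < g"
    and "size \<Delta> = d2" and "sum_mset \<Delta> = 0"
    and "0 \<le> p 0" and "strict_mono_on {0..2 * d2 + g - 1} p" and "p (2 * d2 + g - 1) < l"
  shows "Abs_fps (\<lambda>d1. of_nat (N_pearl l p \<Delta> d1 d2 g)) =
     (\<Sum>K\<in>pearl_chain_classes d2 g.
        fps_const (1 / of_nat (card (aut_group (whites d2) (blacks d2 g) (representative K)))) *
        (\<Sum>v\<in>leak_vectors (whites d2) \<Delta>.
           \<Sum>r | linear_order_on (vertices d2 g) r. feynman_integral (representative K) r v))"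
proof (rule fps_ext)
  fix n
  interpret marked_circle d2 g l p using assms by unfold_locales
  let ?F = "\<lambda>E. \<Sum>v\<in>leak_vectors W \<Delta>. \<Sum>r | linear_order_on V r. feynman_integral E r v"
  have chain: "pearl_chain d2 g W B (representative K)" if "K \<in> pearl_chain_classes d2 g" for K
  proof -
    have "colour_isos W B E E \<noteq> {}" for E :: "(nat \<times> nat) set"
      unfolding colour_isos_eq using id_colour_perm by (force simp: prod.map_id0)
    then show ?thesis using representative_mem[OF that[unfolded pearl_chain_classes_def]] by simp
  qed
  have "fps_nth (Abs_fps (\<lambda>d1. of_nat (N_pearl l p \<Delta> d1 d2 g))) n =
      (\<Sum>E\<in>{E. pearl_chain d2 g W B E}. chain_weight d2 g \<Delta> n E) / of_nat (card (colour_perms W B))"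
    by (simp add: N_pearl_eq_sum_diagrams sum_chain_weight)
  also have "\<dots> = (\<Sum>K\<in>pearl_chain_classes d2 g.
      chain_weight d2 g \<Delta> n (representative K) / of_nat (card (aut_group W B (representative K))))"
    using sum_over_pearl_chain_classes[where F = "chain_weight d2 g \<Delta> n"] chain_weight_map_prod by simp
  also have "\<dots> = (\<Sum>K\<in>pearl_chain_classes d2 g.
      fps_nth (fps_const (1 / of_nat (card (aut_group W B (representative K)))) * ?F (representative K)) n)"
    using chain by (intro sum.cong refl) (simp add: chain_weight_eq_feynman)
  also have "\<dots> = fps_nth (\<Sum>K\<in>pearl_chain_classes d2 g.
      fps_const (1 / of_nat (card (aut_group W B (representative K)))) * ?F (representative K)) n"
    by (simp add: fps_sum_nth)
  finally show "fps_nth (Abs_fps (\<lambda>d1. of_nat (N_pearl l p \<Delta> d1 d2 g))) n = \<dots>" .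
qed

end
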